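(* There exist diffeomorphisms $G\in\mathrm{Diff}^\infty_0(\mathbb{T}\times[0,1])$ which are not total renormalizations of $C^2$-close to identity maps: for such a $G$ there is a neighborhood $\mathcal{N}$ of the identity in $\mathrm{Diff}^2(\mathbb{T}\times[0,1])$ such that $G$ is not a total renormalization of any $g\in\mathcal{N}$.
   Context: $\mathbb{T}=\mathbb{R}/\mathbb{Z}$. $\mathrm{Diff}^r(V)$ has the $C^r$-topology and $\mathrm{Diff}^r_0(V)$ is its identity component. Total renormalization: $G\in\mathrm{Diff}^r(V)$ is a total renormalization of $g\in\mathrm{Diff}^r(V)$ if there is a strict submanifold with corners $\Delta\subsetneq V$ and a bijective local $C^r$-diffeomorphism $H:\Delta\to V$ such that the first return time $\tau:\Delta\to\mathbb{N}^*$ into $\Delta$ by $g$ is (well defined and) bounded, $G=H\circ g^\tau\circ H^{-1}$, and $\bigcup_{n\ge0}g^n(\Delta)=V$. *)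

theory Defs
  imports "HOL-Analysis.Analysis" "HOL-Library.Extended_Nat"
begin

text \<open>
  The partial derivative of \<open>f\<close> in the directions \<open>vs\<close> (the head of the list is taken first),
  relative to \<open>S\<close>. It is used only for \<open>S\<close> open and for the closed strip \<open>\<real> \<times> [0,1]\<close>; in both cases
  the derivative within \<open>S\<close> is unique (one-sided at the boundary of the strip).
\<close>

primrec partials :: "'a::euclidean_space set \<Rightarrow> 'a list \<Rightarrow> ('a \<Rightarrow> 'b::real_normed_vector) \<Rightarrow> 'a \<Rightarrow> 'b"
  where
    "partials S [] f = f"
  | "partials S (v # vs) f = partials S vs (\<lambda>x. frechet_derivative f (at x within S) v)"

definition Cr_on :: "enat \<Rightarrow> 'a::euclidean_space set \<Rightarrow> ('a \<Rightarrow> 'b::real_normed_vector) \<Rightarrow> bool"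
  where "Cr_on r S f \<longleftrightarrow>
    (\<forall>vs. set vs \<subseteq> Basis \<and> enat (length vs) < r \<longrightarrow> partials S vs f differentiable_on S) \<and>
    (\<forall>vs. set vs \<subseteq> Basis \<and> enat (length vs) \<le> r \<longrightarrow> continuous_on S (partials S vs f))"

definition Cr_diffeo_on :: "enat \<Rightarrow> 'a::euclidean_space set \<Rightarrow> ('a \<Rightarrow> 'a) \<Rightarrow> bool"
  where "Cr_diffeo_on r U \<phi> \<longleftrightarrow>
    open U \<and> inj_on \<phi> U \<and> open (\<phi> ` U) \<and> Cr_on r U \<phi> \<and> Cr_on r (\<phi> ` U) (inv_into U \<phi>)"

quotient_type circle = real / "\<lambda>x y. x - y \<in> \<int>"
proof (rule equivpI)
  show "reflp (\<lambda>x y::real. x - y \<in> \<int>)"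
    by (simp add: reflp_def)
  show "symp (\<lambda>x y::real. x - y \<in> \<int>)"
  proof (rule sympI)
    fix x y :: real assume "x - y \<in> \<int>"
    then have "- (x - y) \<in> \<int>" by (rule Ints_minus)
    then show "y - x \<in> \<int>" by simp
  qed
  show "transp (\<lambda>x y::real. x - y \<in> \<int>)"
  proof (rule transpI)
    fix x y z :: real assume "x - y \<in> \<int>" "y - z \<in> \<int>"
    then have "(x - y) + (y - z) \<in> \<int>" by (rule Ints_add)
    then show "x - z \<in> \<int>" by simp
  qed
qed

definition annulus :: "(circle \<times> real) set"
  where "annulus = UNIV \<times> {0..1}"

definition strip :: "(real \<times> real) set"
  where "strip = UNIV \<times> {0..1}"

definition cover :: "real \<times> real \<Rightarrow> circle \<times> real"
  where "cover z = (abs_circle (fst z), snd z)"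

definition is_lift :: "(real \<times> real \<Rightarrow> real \<times> real) \<Rightarrow> (circle \<times> real \<Rightarrow> circle \<times> real) \<Rightarrow> bool"
  where "is_lift F f \<longleftrightarrow> (\<forall>z\<in>strip. f (cover z) = cover (F z))"

text \<open>
  The strip is the universal cover of the annulus, so a self-map of the annulus is of class
  C^r iff it has a (global) lift of class C^r.
\<close>

definition Cr_map :: "enat \<Rightarrow> (circle \<times> real \<Rightarrow> circle \<times> real) \<Rightarrow> bool"
  where "Cr_map r f \<longleftrightarrow> (\<exists>F. Cr_on r strip F \<and> is_lift F f)"

definition Diff :: "enat \<Rightarrow> (circle \<times> real \<Rightarrow> circle \<times> real) set"
  where "Diff r = {f \<in> extensional annulus. bij_betw f annulus annulus \<and>
    Cr_map r f \<and> Cr_map r (inv_into annulus f)}"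

definition id_annulus :: "circle \<times> real \<Rightarrow> circle \<times> real"
  where "id_annulus = restrict id annulus"

text \<open>
  Basic neighbourhoods for the C^r-topology: uniform closeness, for suitable lifts, of all partial
  derivatives up to order \<open>k\<close>. For \<open>r = \<infinity>\<close> one uses all finite \<open>k\<close>.
\<close>

definition Cr_nbhd :: "enat \<Rightarrow> nat \<Rightarrow> real \<Rightarrow> (circle \<times> real \<Rightarrow> circle \<times> real)
    \<Rightarrow> (circle \<times> real \<Rightarrow> circle \<times> real) set"
  where "Cr_nbhd r k e f = {g \<in> Diff r. \<exists>F G. Cr_on r strip F \<and> is_lift F f \<and>
    Cr_on r strip G \<and> is_lift G g \<and>
    (\<forall>vs. set vs \<subseteq> Basis \<and> length vs \<le> k \<longrightarrow>
      (\<forall>z\<in>strip. norm (partials strip vs F z - partials strip vs G z) < e))}"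

definition Cr_open :: "enat \<Rightarrow> (circle \<times> real \<Rightarrow> circle \<times> real) set \<Rightarrow> bool"
  where "Cr_open r W \<longleftrightarrow>
    W \<subseteq> Diff r \<and> (\<forall>f\<in>W. \<exists>k e. enat k \<le> r \<and> e > 0 \<and> Cr_nbhd r k e f \<subseteq> W)"

definition Cr_topology :: "enat \<Rightarrow> (circle \<times> real \<Rightarrow> circle \<times> real) topology"
  where "Cr_topology r = topology (Cr_open r)"

lemma Cr_nbhd_mono:
  assumes "k \<le> k'" "e' \<le> e"
  shows "Cr_nbhd r k' e' f \<subseteq> Cr_nbhd r k e f"
proof
  fix g assume "g \<in> Cr_nbhd r k' e' f"
  then obtain F G where "g \<in> Diff r" "Cr_on r strip F" "is_lift F f" "Cr_on r strip G" "is_lift G g"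
    and *: "\<And>vs z. set vs \<subseteq> Basis \<Longrightarrow> length vs \<le> k' \<Longrightarrow> z \<in> strip \<Longrightarrow>
      norm (partials strip vs F z - partials strip vs G z) < e'"
    unfolding Cr_nbhd_def by blast
  moreover have "norm (partials strip vs F z - partials strip vs G z) < e"
    if "set vs \<subseteq> Basis" "length vs \<le> k" "z \<in> strip" for vs z
    using *[of vs z] that assms by linarith
  ultimately show "g \<in> Cr_nbhd r k e f"
    unfolding Cr_nbhd_def by blast
qed

lemma istopology_Cr_open: "istopology (Cr_open r)"
  unfolding istopology_def
proof (intro conjI allI impI)
  fix S T assume S: "Cr_open r S" and T: "Cr_open r T"
  have "\<exists>k e. enat k \<le> r \<and> e > 0 \<and> Cr_nbhd r k e f \<subseteq> S \<inter> T" if f: "f \<in> S \<inter> T" for f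
  proof -
    obtain k1 e1 where 1: "enat k1 \<le> r" "e1 > 0" "Cr_nbhd r k1 e1 f \<subseteq> S"
      using S f unfolding Cr_open_def by blast
    obtain k2 e2 where 2: "enat k2 \<le> r" "e2 > 0" "Cr_nbhd r k2 e2 f \<subseteq> T"
      using T f unfolding Cr_open_def by blast
    have "Cr_nbhd r (max k1 k2) (min e1 e2) f \<subseteq> S \<inter> T"
      using 1(3) 2(3) Cr_nbhd_mono[of k1 "max k1 k2" "min e1 e2" e1 r f]
        Cr_nbhd_mono[of k2 "max k1 k2" "min e1 e2" e2 r f] by auto
    moreover have "enat (max k1 k2) \<le> r" "min e1 e2 > 0"
      using 1 2 by (auto simp: max_def)
    ultimately show ?thesis by blast
  qed
  with S T show "Cr_open r (S \<inter> T)"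
    unfolding Cr_open_def by blast
next
  fix K assume K: "\<forall>S\<in>K. Cr_open r S"
  show "Cr_open r (\<Union>K)"
    unfolding Cr_open_def
  proof (intro conjI ballI)
    show "\<Union>K \<subseteq> Diff r"
      using K unfolding Cr_open_def by blast
    fix f assume "f \<in> \<Union>K"
    then obtain S where S: "S \<in> K" "f \<in> S" by blast
    then obtain k e where "enat k \<le> r" "e > 0" "Cr_nbhd r k e f \<subseteq> S"
      using K unfolding Cr_open_def by blast
    with S(1) show "\<exists>k e. enat k \<le> r \<and> e > 0 \<and> Cr_nbhd r k e f \<subseteq> \<Union>K"
      by blast
  qed
qed

lemma openin_Cr_topology: "openin (Cr_topology r) W \<longleftrightarrow> Cr_open r W"
  by (simp add: Cr_topology_def topology_inverse' istopology_Cr_open)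

lemma topspace_Cr_topology: "topspace (Cr_topology r) = Diff r"
proof
  show "topspace (Cr_topology r) \<subseteq> Diff r"
    unfolding topspace_def openin_Cr_topology Cr_open_def by blast
  have "Cr_nbhd r 0 1 f \<subseteq> Diff r" for f
    unfolding Cr_nbhd_def by blast
  then have "Cr_open r (Diff r)"
    unfolding Cr_open_def
    by (intro conjI ballI exI[of _ 0] exI[of _ 1]) (auto simp flip: zero_enat_def)
  then show "Diff r \<subseteq> topspace (Cr_topology r)"
    by (simp add: openin_Cr_topology openin_subset)
qed

definition Diff0 :: "enat \<Rightarrow> (circle \<times> real \<Rightarrow> circle \<times> real) set"
  where "Diff0 r = connected_component_of_set (Cr_topology r) id_annulus"

definition orthant :: "'a::euclidean_space set \<Rightarrow> 'a set"
  where "orthant I = {w. \<forall>i\<in>I. 0 \<le> w \<bullet> i}"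

text \<open>
  A submanifold with corners (of full dimension, as it is to be locally diffeomorphic to the
  annulus): near each of its points there is a chart of the annulus, with values in the orthant
  \<open>orthant I\<close>, in which \<open>\<Delta>\<close> is cut out by requiring further coordinates to be nonnegative. As the
  condition concerns points of \<open>\<Delta>\<close> only, \<open>\<Delta>\<close> need not be closed:
  \<open>\<Delta>\<close> may be the image of \<open>[0,a) \<times> [0,1]\<close>. Charts are written in the coordinates of the
  universal cover; those at boundary points extend to open subsets of \<open>\<real> \<times> \<real>\<close>.
\<close>

definition submanifold_with_corners :: "enat \<Rightarrow> (circle \<times> real) set \<Rightarrow> bool"
  where "submanifold_with_corners r \<Delta> \<longleftrightarrow> \<Delta> \<subseteq> annulus \<and>
    (\<forall>z. cover z \<in> \<Delta> \<longrightarrow> (\<exists>U \<phi> I J. z \<in> U \<and> Cr_diffeo_on r U \<phi> \<and> I \<subseteq> J \<and> J \<subseteq> Basis \<and>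
      \<phi> ` (U \<inter> strip) = \<phi> ` U \<inter> orthant I \<and>
      \<phi> ` (U \<inter> cover -` \<Delta>) = \<phi> ` U \<inter> orthant J))"

text \<open>
  A local C^r-diffeomorphism on \<open>\<Delta>\<close> is locally the restriction of a C^r-diffeomorphism between open
  subsets of the ambient surface. It need not be an open map:
  the bijection from \<open>[0,a) \<times> [0,1]\<close> to the annulus that rescales the first coordinate
  is a local diffeomorphism.
\<close>

definition local_Cr_diffeo :: "enat \<Rightarrow> (circle \<times> real) set \<Rightarrow> (circle \<times> real \<Rightarrow> circle \<times> real) \<Rightarrow> bool"
  where "local_Cr_diffeo r \<Delta> H \<longleftrightarrow>
    (\<forall>z. cover z \<in> \<Delta> \<longrightarrow> (\<exists>U \<Phi>. z \<in> U \<and> Cr_diffeo_on r U \<Phi> \<and>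
      (\<forall>w\<in>U. cover w \<in> \<Delta> \<longrightarrow> H (cover w) = cover (\<Phi> w))))"

definition return_time :: "('a \<Rightarrow> 'a) \<Rightarrow> 'a set \<Rightarrow> 'a \<Rightarrow> nat"
  where "return_time g \<Delta> x = (LEAST n. 1 \<le> n \<and> (g ^^ n) x \<in> \<Delta>)"

definition first_return :: "('a \<Rightarrow> 'a) \<Rightarrow> 'a set \<Rightarrow> 'a \<Rightarrow> 'a"
  where "first_return g \<Delta> x = (g ^^ return_time g \<Delta> x) x"

definition is_total_renormalization ::
    "enat \<Rightarrow> (circle \<times> real \<Rightarrow> circle \<times> real) \<Rightarrow> (circle \<times> real \<Rightarrow> circle \<times> real) \<Rightarrow> bool"
  where "is_total_renormalization r G g \<longleftrightarrow> G \<in> Diff r \<and> g \<in> Diff r \<and>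
    (\<exists>\<Delta> H. submanifold_with_corners r \<Delta> \<and> \<Delta> \<subset> annulus \<and>
      bij_betw H \<Delta> annulus \<and> local_Cr_diffeo r \<Delta> H \<and>
      (\<forall>x\<in>\<Delta>. \<exists>n\<ge>1. (g ^^ n) x \<in> \<Delta>) \<and> (\<exists>N. \<forall>x\<in>\<Delta>. return_time g \<Delta> x \<le> N) \<and>
      (\<forall>p\<in>annulus. G p = H (first_return g \<Delta> (inv_into \<Delta> H p))) \<and>
      (\<Union>n. (g ^^ n) ` \<Delta>) = annulus)"

end

theory Submission
  imports Defs
begin

text \<open>
  All orbits of \<open>G\<close> converge to fixed points, at which \<open>G\<close> is diagonal with entries \<open>1/2\<close> or \<open>3/2\<close>. Suppose that
  \<open>G\<close> is a total renormalization, on a domain \<open>\<Delta>\<close>, of a map \<open>g\<close> that is \<open>C\<^sup>2\<close>-close to the identity, and let \<open>\<phi>\<close>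
  be the circle map induced by \<open>g\<close> on one boundary component. As \<open>\<Delta>\<close> is locally closed and its return
  time is bounded, a minimal set of \<open>\<phi>\<close> has a relatively open piece inside (a preimage of) \<open>\<Delta>\<close>, hence
  contains a point that is recurrent through \<open>\<Delta>\<close>. As \<open>H\<close> is continuous on \<open>\<Delta>\<close>, it sends this point to a
  recurrent, hence fixed, point of \<open>G\<close>; so \<open>\<phi>\<close> has a periodic point \<open>s\<close>. By the argument of Denjoy its multiplier
  \<open>\<mu>\<close> is close to 1, because the variation of \<open>ln \<phi>'\<close> is small. But \<open>\<Delta>\<close> contains an arc of the boundary that
  ends at \<open>s\<close>, and along it \<open>H\<close> conjugates the return of \<open>g\<close> near \<open>s\<close> to some iterate \<open>G\<^sup>j\<close> with \<open>j \<ge> 1\<close>; thus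
  \<open>\<mu>\<close> is an eigenvalue of the derivative of \<open>G\<^sup>j\<close> at a fixed point, that is, \<open>(1/2)\<^sup>j\<close> or \<open>(3/2)\<^sup>j\<close>.
\<close>

section \<open>The maps \<open>x + a sin(bx)/b\<close>\<close>

text \<open>When \<open>\<bar>a\<bar> < 1\<close>, the choice \<open>b = 2 * pi\<close> gives the
  lift of a circle map and \<open>b = pi\<close> a map preserving the unit interval. For
  \<open>a \<noteq> 0\<close> the fixed points are the multiples of \<open>pi / b\<close>, with
  derivative \<open>1 + a\<close> or \<open>1 - a\<close>; at \<open>a = 0\<close> the map is the
  identity, so \<open>a\<close> also parametrizes an isotopy.\<close>

definition sine_map :: "real \<Rightarrow> real \<Rightarrow> real \<Rightarrow> real"
  where "sine_map b a x = x + a * sin (b * x) / b"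

lemma sine_map_has_real_derivative:
  assumes "b \<noteq> 0"
  shows "(sine_map b a has_real_derivative 1 + a * cos (b * x)) (at x within S)"
  unfolding sine_map_def using assms by (auto intro!: derivative_eq_intros)

lemma isCont_sine_map: "b \<noteq> 0 \<Longrightarrow> isCont (sine_map b a) x"
  using DERIV_isCont sine_map_has_real_derivative by blast

lemma one_plus_cos_pos:
  fixes a :: real
  assumes "\<bar>a\<bar> < 1"
  shows "0 < 1 + a * cos x"
proof -
  have "\<bar>a * cos x\<bar> \<le> \<bar>a\<bar> * 1"
    unfolding abs_mult by (intro mult_left_mono) auto
  then show ?thesis using assms by linarith
qed

lemma strict_mono_sine_map:
  assumes "b \<noteq> 0" "\<bar>a\<bar> < 1"
  shows "strict_mono (sine_map b a)"
proof (rule strict_monoI)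
  fix x y :: real assume "x < y"
  then show "sine_map b a x < sine_map b a y"
  proof (rule DERIV_pos_imp_increasing)
    show "\<exists>y. (sine_map b a has_real_derivative y) (at z) \<and> 0 < y" for z
      using sine_map_has_real_derivative[OF assms(1), of a z UNIV] one_plus_cos_pos[OF assms(2)]
      by blast
  qed
qed

text \<open>The displacement is at most \<open>\<bar>a\<bar> / \<bar>b\<bar>\<close>, so the
  intermediate value theorem applies on an interval of that radius around \<open>y\<close>.\<close>

lemma surj_sine_map:
  assumes "b \<noteq> 0"
  shows "surj (sine_map b a)"
proof -
  have "\<exists>x. sine_map b a x = y" for y
  proof -
    define c where "c = \<bar>a\<bar> / \<bar>b\<bar>"
    have c: "\<bar>a * sin (b * x) / b\<bar> \<le> c" for x
      unfolding c_def abs_divide abs_mult by (intro divide_right_mono mult_left_le) auto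
    have "sine_map b a (y - c) \<le> y" "y \<le> sine_map b a (y + c)"
      using c[of "y - c"] c[of "y + c"] unfolding sine_map_def by linarith+
    moreover have "y - c \<le> y + c"
      by (simp add: c_def)
    ultimately show ?thesis
      using IVT[of "sine_map b a" "y - c" y "y + c"] isCont_sine_map[OF assms] by blast
  qed
  then show ?thesis unfolding surj_def by metis
qed

lemma bij_sine_map:
  assumes "b \<noteq> 0" "\<bar>a\<bar> < 1"
  shows "bij (sine_map b a)"
  using strict_mono_imp_inj_on[OF strict_mono_sine_map[OF assms]] surj_sine_map[OF assms(1)]
  by (simp add: bij_def)

text \<open>The derivative of the map never vanishes and the inverse is continuous, so the inverse
  function rule applies. Writing the result as a function of \<open>inv (sine_map b a) y\<close>
  prepares for repeated differentiation.\<close>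

lemma inv_sine_map_has_real_derivative:
  assumes "b \<noteq> 0" "\<bar>a\<bar> < 1"
  shows "(inv (sine_map b a) has_real_derivative inverse (1 + a * cos (b * inv (sine_map b a) y))) (at y)"
proof -
  note bij = bij_sine_map[OF assms]
  have "inv (sine_map b a) (sine_map b a x) = x" for x
    using bij by (simp add: bij_is_inj)
  then have "isCont (inv (sine_map b a)) (sine_map b a (inv (sine_map b a) y))"
    using isCont_sine_map[OF assms(1)]
      isCont_inverse_function[of 1 "inv (sine_map b a) y" "inv (sine_map b a)" "sine_map b a"] by simp
  moreover have right_inv: "sine_map b a (inv (sine_map b a) y) = y" for y
    using bij by (simp add: bij_is_surj surj_f_inv_f)
  ultimately have "isCont (inv (sine_map b a)) y"
    by simp
  with sine_map_has_real_derivative[OF assms(1)] show ?thesis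
    using right_inv one_plus_cos_pos[OF assms(2), of "b * inv (sine_map b a) y"]
    by (intro DERIV_inverse_function[where a = "y - 1" and b = "y + 1" and f = "sine_map b a"]) simp_all
qed

lemma sine_map_add:
  assumes "b \<noteq> 0" "sin (b * c) = 0" "cos (b * c) = 1"
  shows "sine_map b a (x + c) = sine_map b a x + c"
  using assms by (simp add: sine_map_def distrib_left sin_add)

lemma sine_map_fixed_iff:
  assumes "b \<noteq> 0" "a \<noteq> 0"
  shows "sine_map b a x = x \<longleftrightarrow> sin (b * x) = 0"
  using assms by (simp add: sine_map_def)

section \<open>Convergence of orbits to fixed points\<close>

lemma monotone_iterates_converge:
  fixes f :: "real \<Rightarrow> real"
  assumes mono: "mono f" and cont: "\<And>x. isCont f x"
    and fixed: "\<And>x. \<exists>c\<le>x. f c = c" "\<And>x. \<exists>c\<ge>x. f c = c"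
  shows "\<exists>q. (\<lambda>n. (f ^^ n) x) \<longlonglongrightarrow> q \<and> f q = q"
proof -
  have iter_le: "(f ^^ n) u \<le> (f ^^ n) v" if "u \<le> v" for u v n
    using that by (induction n) (auto intro: monoD[OF mono])
  have iter_fix: "(f ^^ n) c = c" if "f c = c" for c n
    using that by (induction n) auto
  \<comment> \<open>The orbit is trapped between two fixed points and is monotone, in the direction
    of its first step; by continuity its limit is fixed.\<close>
  obtain c d where c: "c \<le> x" "f c = c" and d: "x \<le> d" "f d = d"
    using fixed[of x] by blast
  have bdd: "c \<le> (f ^^ n) x" "(f ^^ n) x \<le> d" for n
    using iter_le[OF c(1), of n] iter_le[OF d(1), of n] iter_fix[OF c(2)] iter_fix[OF d(2)] by auto
  have "monoseq (\<lambda>n. (f ^^ n) x)"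
  proof (cases "x \<le> f x")
    case True
    then have "(f ^^ n) x \<le> (f ^^ Suc n) x" for n
      using iter_le[of x "f x" n] by (simp only: funpow_Suc_right o_apply)
    then show ?thesis by (simp add: monoseq_Suc)
  next
    case False
    then have "(f ^^ Suc n) x \<le> (f ^^ n) x" for n
      using iter_le[of "f x" x n] by (simp only: funpow_Suc_right o_apply)
    then show ?thesis by (simp add: monoseq_Suc)
  qed
  moreover have "Bseq (\<lambda>n. (f ^^ n) x)"
  proof (rule BseqI')
    show "norm ((f ^^ n) x) \<le> \<bar>c\<bar> + \<bar>d\<bar>" for n
      using bdd[of n] by simp
  qed
  ultimately obtain q where q: "(\<lambda>n. (f ^^ n) x) \<longlonglongrightarrow> q"
    using Bseq_monoseq_convergent by (auto simp: convergent_def)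
  then have "(\<lambda>n. f ((f ^^ n) x)) \<longlonglongrightarrow> f q"
    using cont isCont_tendsto_compose by blast
  then have "(\<lambda>n. (f ^^ Suc n) x) \<longlonglongrightarrow> f q"
    by simp
  then have "f q = q"
    using q LIMSEQ_unique LIMSEQ_Suc by blast
  with q show ?thesis by blast
qed

lemma sine_map_int_pi:
  assumes "b \<noteq> 0"
  shows "sine_map b a (of_int n * pi / b) = of_int n * pi / b"
proof -
  have "sin (b * (of_int n * pi / b)) = 0"
    using assms sin_zero_iff_int2 by auto
  then show ?thesis
    by (simp add: sine_map_def)
qed

lemma sine_map_iterates_converge:
  assumes "b > 0" "\<bar>a\<bar> < 1" 
  shows "\<exists>q. (\<lambda>n. (sine_map b a ^^ n) x) \<longlonglongrightarrow> q \<and> sine_map b a q = q"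
proof (rule monotone_iterates_converge)
  show "mono (sine_map b a)"
    using assms by (intro strict_mono_mono strict_mono_sine_map) auto
  show "isCont (sine_map b a) x" for x
    using assms by (simp add: isCont_sine_map)
  show "\<exists>c\<le>x. sine_map b a c = c" for x
  proof (intro exI conjI)
    \<comment> \<open>The fixed point below \<open>x\<close> is the largest multiple of
      \<open>pi / b\<close> not exceeding it.\<close>
    have "of_int \<lfloor>b * x / pi\<rfloor> * pi \<le> b * x / pi * pi"
      by (intro mult_right_mono) auto
    then show "of_int \<lfloor>b * x / pi\<rfloor> * pi / b \<le> x"
      using assms by (simp add: pos_divide_le_eq mult.commute)
  qed (use assms sine_map_int_pi in auto)
  show "\<exists>c\<ge>x. sine_map b a c = c" for x
  proof (intro exI conjI)
    have "b * x / pi * pi \<le> of_int \<lceil>b * x / pi\<rceil> * pi"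
      by (intro mult_right_mono) auto
    then show "x \<le> of_int \<lceil>b * x / pi\<rceil> * pi / b"
      using assms by (simp add: pos_le_divide_eq mult.commute)
  qed (use assms sine_map_int_pi in auto)
qed

lemma sine_map_funpow_has_real_derivative:
  assumes "b \<noteq> 0" "sine_map b a q = q"
  shows "((sine_map b a ^^ n) has_real_derivative (1 + a * cos (b * q)) ^ n) (at q)"
proof (induction n)
  case 0
  then show ?case by (simp add: id_def)
next
  case (Suc n)
  have "(sine_map b a ^^ n) q = q"
    using assms(2) by (induction n) auto
  then have "(sine_map b a has_real_derivative 1 + a * cos (b * q)) (at ((sine_map b a ^^ n) q))"
    using sine_map_has_real_derivative[OF assms(1)] by simp
  from DERIV_chain[OF this Suc] show ?case
    by (simp add: o_def)
qed

section \<open>Families of functions closed under differentiation\<close>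

definition deriv_closed :: "(real \<Rightarrow> real) set \<Rightarrow> bool"
  where "deriv_closed \<U> \<longleftrightarrow>
    (\<forall>u\<in>\<U>. \<exists>u'\<in>\<U>. \<forall>x. (u has_real_derivative u' x) (at x))"

definition affine_trig :: "real \<Rightarrow> (real \<Rightarrow> real) set"
  where "affine_trig b = {\<lambda>x. l * x + m + p * sin (b * x) + q * cos (b * x) | l m p q. True}"

text \<open>Without the linear term of \<open>affine_trig\<close> the members are bounded, as is
  needed for the difference of two model maps.\<close>

definition trig :: "real \<Rightarrow> (real \<Rightarrow> real) set"
  where "trig b = {\<lambda>x. m + p * sin (b * x) + q * cos (b * x) | m p q. True}"

lemma trigI: "u = (\<lambda>x. m + p * sin (b * x) + q * cos (b * x)) \<Longrightarrow> u \<in> trig b"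
  unfolding trig_def by blast

lemma affine_trigI: "u = (\<lambda>x. l * x + m + p * sin (b * x) + q * cos (b * x)) \<Longrightarrow> u \<in> affine_trig b"
  unfolding affine_trig_def by blast

lemma deriv_closed_trig: "deriv_closed (trig b)"
  unfolding deriv_closed_def
proof
  fix u assume "u \<in> trig b"
  then obtain m p q where u: "u = (\<lambda>x. m + p * sin (b * x) + q * cos (b * x))"
    unfolding trig_def by blast
  show "\<exists>u'\<in>trig b. \<forall>x. (u has_real_derivative u' x) (at x)"
  proof (intro bexI allI)
    show "(u has_real_derivative 0 + (- (q * b)) * sin (b * x) + (p * b) * cos (b * x)) (at x)" for x
      unfolding u by (auto intro!: derivative_eq_intros)
  qed (rule trigI, rule refl)
qed

lemma deriv_closed_affine_trig: "deriv_closed (affine_trig b)"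
  unfolding deriv_closed_def
proof
  fix u assume "u \<in> affine_trig b"
  then obtain l m p q where u: "u = (\<lambda>x. l * x + m + p * sin (b * x) + q * cos (b * x))"
    unfolding affine_trig_def by blast
  show "\<exists>u'\<in>affine_trig b. \<forall>x. (u has_real_derivative u' x) (at x)"
  proof (intro bexI allI)
    show "(u has_real_derivative 0 * x + l + (- (q * b)) * sin (b * x) + (p * b) * cos (b * x)) (at x)" for x
      unfolding u by (auto intro!: derivative_eq_intros)
  qed (rule affine_trigI, rule refl)
qed

text \<open>Closed under differentiation, and contains the derivative of the inverse of \<open>sine_map b a\<close> composed with
  \<open>sine_map b a\<close>: so composing its elements with that inverse again gives a set closed under
  differentiation.\<close>

inductive_set cos_alg :: "real \<Rightarrow> real \<Rightarrow> (real \<Rightarrow> real) set"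
  for b a :: real
  where
    const: "(\<lambda>_. c) \<in> cos_alg b a"
  | ident: "(\<lambda>x. x) \<in> cos_alg b a"
  | sin: "(\<lambda>x. sin (b * x)) \<in> cos_alg b a"
  | cos: "(\<lambda>x. cos (b * x)) \<in> cos_alg b a"
  | inverse: "(\<lambda>x. inverse (1 + a * cos (b * x))) \<in> cos_alg b a"
  | add: "r \<in> cos_alg b a \<Longrightarrow> s \<in> cos_alg b a \<Longrightarrow> (\<lambda>x. r x + s x) \<in> cos_alg b a"
  | mult: "r \<in> cos_alg b a \<Longrightarrow> s \<in> cos_alg b a \<Longrightarrow> (\<lambda>x. r x * s x) \<in> cos_alg b a"

lemma deriv_closed_cos_alg:
  assumes "\<bar>a\<bar> < 1"
  shows "deriv_closed (cos_alg b a)"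
  unfolding deriv_closed_def
proof
  fix u assume "u \<in> cos_alg b a"
  then show "\<exists>u'\<in>cos_alg b a. \<forall>x. (u has_real_derivative u' x) (at x)"
  proof induction
    case (const c)
    show ?case
      by (intro bexI[of _ "\<lambda>_. 0"] cos_alg.const) simp
  next
    case ident
    show ?case
      by (intro bexI[of _ "\<lambda>_. 1"] cos_alg.const) simp
  next
    case sin
    have "(\<lambda>x. b * cos (b * x)) \<in> cos_alg b a"
      by (intro cos_alg.intros)
    then show ?case
      by (rule rev_bexI) (auto intro!: derivative_eq_intros)
  next
    case cos
    have "(\<lambda>x. - b * sin (b * x)) \<in> cos_alg b a"
      by (intro cos_alg.intros)
    then show ?case
      by (rule rev_bexI) (auto intro!: derivative_eq_intros)
  next
    case inverse
    have "(\<lambda>x. a * b * (sin (b * x) * (inverse (1 + a * cos (b * x)) * inverse (1 + a * cos (b * x)))))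
        \<in> cos_alg b a"
      by (intro cos_alg.intros)
    then show ?case
      using one_plus_cos_pos[OF assms]
      by (rule_tac rev_bexI) (auto intro!: derivative_eq_intros simp: less_imp_neq[symmetric])
  next
    case (add r s)
    then obtain r' s' where "r' \<in> cos_alg b a" "s' \<in> cos_alg b a"
      and "\<And>x. (r has_real_derivative r' x) (at x)" "\<And>x. (s has_real_derivative s' x) (at x)"
      by blast
    then show ?case
      by (intro bexI[of _ "\<lambda>x. r' x + s' x"] cos_alg.intros allI DERIV_add)
  next
    case (mult r s)
    then obtain r' s' where r's': "r' \<in> cos_alg b a" "s' \<in> cos_alg b a"
      and "\<And>x. (r has_real_derivative r' x) (at x)" "\<And>x. (s has_real_derivative s' x) (at x)"
      by blast
    then have "((\<lambda>x. r x * s x) has_real_derivative r' x * s x + s' x * r x) (at x)" for x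
      by (intro DERIV_mult)
    then show ?case
      using r's' mult by (intro bexI[of _ "\<lambda>x. r' x * s x + s' x * r x"] cos_alg.intros) auto
  qed
qed

lemma deriv_closed_inv_sine_map:
  assumes "b \<noteq> 0" "\<bar>a\<bar> < 1"
  shows "deriv_closed ((\<lambda>r x. r (inv (sine_map b a) x)) ` cos_alg b a)"
  unfolding deriv_closed_def
proof (intro ballI)
  fix u assume "u \<in> (\<lambda>r x. r (inv (sine_map b a) x)) ` cos_alg b a"
  then obtain r where r: "r \<in> cos_alg b a" "u = (\<lambda>x. r (inv (sine_map b a) x))" by blast
  then obtain r' where r': "r' \<in> cos_alg b a" "\<And>x. (r has_real_derivative r' x) (at x)"
    using deriv_closed_cos_alg[OF assms(2)] unfolding deriv_closed_def by blast
  \<comment> \<open>By the chain rule the derivative of \<open>u\<close> is again a member of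
    \<open>cos_alg b a\<close> composed with the inverse; \<open>s\<close> is that member.\<close>
  define s where "s x = r' x * inverse (1 + a * cos (b * x))" for x
  have "s \<in> cos_alg b a"
    unfolding s_def by (intro cos_alg.intros r')
  moreover have "(u has_real_derivative s (inv (sine_map b a) x)) (at x)" for x
    unfolding r s_def by (rule DERIV_chain2[OF r'(2) inv_sine_map_has_real_derivative[OF assms]])
  ultimately show "\<exists>u'\<in>(\<lambda>r x. r (inv (sine_map b a) x)) ` cos_alg b a.
      \<forall>x. (u has_real_derivative u' x) (at x)"
    by (intro bexI[of _ "\<lambda>x. s (inv (sine_map b a) x)"]) auto
qed

section \<open>The model diffeomorphisms of the annulus\<close>

lemma partials_cong:
  assumes "\<And>x. x \<in> S \<Longrightarrow> f x = g x" "z \<in> S"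
  shows "partials S vs f z = partials S vs g z"
  using assms(1)
proof (induction vs arbitrary: f g)
  case Nil
  then show ?case using assms(2) by simp
next
  case (Cons v vs)
  have "frechet_derivative f (at x within S) = frechet_derivative g (at x within S)" if "x \<in> S" for x
  proof -
    have "(f has_derivative D) (at x within S) \<longleftrightarrow> (g has_derivative D) (at x within S)" for D
      using has_derivative_transform[OF that, of f g] has_derivative_transform[OF that, of g f]
        Cons.prems by metis
    then show ?thesis by (simp add: frechet_derivative_def)
  qed
  then show ?case
    unfolding partials.simps by (intro Cons.IH) simp
qed

lemma Basis_real2: "(Basis :: (real \<times> real) set) = {(1, 0), (0, 1)}"
  by (auto simp: Basis_prod_def)

text \<open>From each point of the strip one can move a little along every basis vector without
  leaving it, which makes the derivative unique even on the boundary.\<close>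

lemma frechet_derivative_strip:
  fixes f :: "real \<times> real \<Rightarrow> 'b::real_normed_vector"
  assumes "z \<in> strip" "(f has_derivative D) (at z within strip)"
  shows "frechet_derivative f (at z within strip) = D"
proof (rule frechet_derivative_unique_within[OF _ assms(2)])
  show "(f has_derivative frechet_derivative f (at z within strip)) (at z within strip)"
    using assms(2) frechet_derivative_works differentiable_def by blast
  show "\<exists>d. 0 < \<bar>d\<bar> \<and> \<bar>d\<bar> < e \<and> z + d *\<^sub>R i \<in> strip"
    if i: "i \<in> Basis" and e: "0 < e" for i :: "real \<times> real" and e
  proof -
    \<comment> \<open>The sign points towards the middle of the strip, and the cap
      \<open>1/2\<close> prevents leaving it on the other side.\<close>
    define d where "d = (if snd z \<le> 1/2 then min (e/2) (1/2) else - min (e/2) (1/2))"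
    have "0 < \<bar>d\<bar>" "\<bar>d\<bar> < e" "z + d *\<^sub>R i \<in> strip"
      using e i assms(1) by (auto simp: d_def strip_def Basis_real2 min_def split: if_splits)
    then show ?thesis by blast
  qed
qed

definition prod_map :: "(real \<Rightarrow> real) \<Rightarrow> (real \<Rightarrow> real) \<Rightarrow> real \<times> real \<Rightarrow> real \<times> real"
  where "prod_map u v z = (u (fst z), v (snd z))"

lemma prod_map_has_derivative:
  assumes "(u has_real_derivative u') (at (fst z))" "(v has_real_derivative v') (at (snd z))"
  shows "(prod_map u v has_derivative (\<lambda>w. (u' * fst w, v' * snd w))) (at z within S)"
proof -
  have "((\<lambda>z. u (fst z)) has_derivative (\<lambda>w. u' * fst w)) (at z within S)"
    using has_derivative_compose[OF has_derivative_fst[OF has_derivative_ident]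
        assms(1)[unfolded has_field_derivative_def]] .
  moreover have "((\<lambda>z. v (snd z)) has_derivative (\<lambda>w. v' * snd w)) (at z within S)"
    using has_derivative_compose[OF has_derivative_snd[OF has_derivative_ident]
        assms(2)[unfolded has_field_derivative_def]] .
  ultimately show ?thesis
    unfolding prod_map_def by (rule has_derivative_Pair)
qed

text \<open>The derivative of a product map is diagonal: a basis direction differentiates one
  component and kills the other. Hence iterated partials stay product maps with factors in the two
  families.\<close>

lemma partials_prod_map:
  assumes UV: "deriv_closed \<U>" "deriv_closed \<V>" "(\<lambda>_. 0) \<in> \<U>" "(\<lambda>_. 0) \<in> \<V>"
    and "u \<in> \<U>" "v \<in> \<V>" "set vs \<subseteq> Basis"
  shows "\<exists>u1\<in>\<U>. \<exists>v1\<in>\<V>. \<forall>z\<in>strip. partials strip vs (prod_map u v) z = prod_map u1 v1 z"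
  using assms(5-)
proof (induction vs arbitrary: u v)
  case Nil
  then show ?case by auto
next
  case (Cons e vs)
  obtain u' where u': "u' \<in> \<U>" "\<And>x. (u has_real_derivative u' x) (at x)"
    using UV(1) Cons.prems(1) unfolding deriv_closed_def by blast
  obtain v' where v': "v' \<in> \<V>" "\<And>x. (v has_real_derivative v' x) (at x)"
    using UV(2) Cons.prems(2) unfolding deriv_closed_def by blast
  define u1 v1 where "u1 = (if e = (1, 0) then u' else (\<lambda>_. 0))"
    and "v1 = (if e = (1, 0) then (\<lambda>_. 0) else v')"
  have uv1: "u1 \<in> \<U>" "v1 \<in> \<V>"
    using UV u' v' by (auto simp: u1_def v1_def)
  have "partials strip (e # vs) (prod_map u v) z = partials strip vs (prod_map u1 v1) z"
    if "z \<in> strip" for z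
    unfolding partials.simps
  proof (rule partials_cong[OF _ that])
    fix x :: "real \<times> real" assume "x \<in> strip"
    then have "frechet_derivative (prod_map u v) (at x within strip) =
        (\<lambda>w. (u' (fst x) * fst w, v' (snd x) * snd w))"
      using u' v' by (intro frechet_derivative_strip prod_map_has_derivative) auto
    then show "frechet_derivative (prod_map u v) (at x within strip) e = prod_map u1 v1 x"
      using Cons.prems(3) by (auto simp: Basis_real2 u1_def v1_def prod_map_def)
  qed
  then show ?case
    using Cons.IH[OF uv1] Cons.prems(3) by auto
qed

lemma partials_prod_map_differentiable_on:
  assumes "deriv_closed \<U>" "deriv_closed \<V>" "(\<lambda>_. 0) \<in> \<U>" "(\<lambda>_. 0) \<in> \<V>"
    and "u \<in> \<U>" "v \<in> \<V>" "set vs \<subseteq> Basis"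
  shows "partials strip vs (prod_map u v) differentiable_on strip"
proof -
  obtain u1 v1 where uv: "u1 \<in> \<U>" "v1 \<in> \<V>"
    and eq: "\<And>z. z \<in> strip \<Longrightarrow> partials strip vs (prod_map u v) z = prod_map u1 v1 z"
    using partials_prod_map[OF assms] by blast
  obtain u' v' where u': "\<And>x. (u1 has_real_derivative u' x) (at x)"
    and v': "\<And>x. (v1 has_real_derivative v' x) (at x)"
    using assms(1,2) uv unfolding deriv_closed_def by blast
  show ?thesis
    unfolding differentiable_on_def differentiable_def
    using has_derivative_transform[OF _ eq prod_map_has_derivative[OF u' v']] by blast
qed

lemma Cr_on_prod_map:
  assumes "deriv_closed \<U>" "deriv_closed \<V>" "(\<lambda>_. 0) \<in> \<U>" "(\<lambda>_. 0) \<in> \<V>"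
    and "u \<in> \<U>" "v \<in> \<V>"
  shows "Cr_on r strip (prod_map u v)"
  using partials_prod_map_differentiable_on[OF assms] differentiable_imp_continuous_on
  unfolding Cr_on_def by blast

text \<open>Since \<open>frechet_derivative\<close> is a choice operator, linearity requires
  differentiability at every stage; hence the assumptions on all iterated partials.\<close>

lemma partials_strip_add_scaleR:
  fixes f g :: "real \<times> real \<Rightarrow> 'b::real_normed_vector"
  assumes "\<And>ws. set ws \<subseteq> Basis \<Longrightarrow> partials strip ws f differentiable_on strip"
    and "\<And>ws. set ws \<subseteq> Basis \<Longrightarrow> partials strip ws g differentiable_on strip"
    and "set vs \<subseteq> Basis" "z \<in> strip"
  shows "partials strip vs (\<lambda>x. f x + c *\<^sub>R g x) z = partials strip vs f z + c *\<^sub>R partials strip vs g z"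
  using assms(1-3)
proof (induction vs arbitrary: f g)
  case (Cons v vs)
  let ?f = "\<lambda>x. frechet_derivative f (at x within strip) v"
  let ?g = "\<lambda>x. frechet_derivative g (at x within strip) v"
  have "partials strip (v # vs) (\<lambda>x. f x + c *\<^sub>R g x) z = partials strip vs (\<lambda>x. ?f x + c *\<^sub>R ?g x) z"
    unfolding partials.simps
  proof (rule partials_cong[OF _ assms(4)])
    fix x :: "real \<times> real" assume x: "x \<in> strip"
    have "f differentiable (at x within strip)" "g differentiable (at x within strip)"
      using Cons.prems(1)[of "[]"] Cons.prems(2)[of "[]"] x by (auto simp: differentiable_on_def)
    then have "((\<lambda>x. f x + c *\<^sub>R g x) has_derivative (\<lambda>w. frechet_derivative f (at x within strip) w +
        c *\<^sub>R frechet_derivative g (at x within strip) w)) (at x within strip)"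
      unfolding frechet_derivative_works by (intro derivative_intros)
    with x show "frechet_derivative (\<lambda>x. f x + c *\<^sub>R g x) (at x within strip) v = ?f x + c *\<^sub>R ?g x"
      by (subst frechet_derivative_strip) auto
  qed
  also have "\<dots> = partials strip vs ?f z + c *\<^sub>R partials strip vs ?g z"
    using Cons.prems Cons.prems(1)[of "v # _"] Cons.prems(2)[of "v # _"] by (intro Cons.IH) auto
  finally show ?case by simp
qed simp

section \<open>Lifts to the strip and maps of the annulus\<close>

lemma cover_eq_iff: "cover z = cover w \<longleftrightarrow> fst z - fst w \<in> \<int> \<and> snd z = snd w"
  by (simp add: cover_def circle.abs_eq_iff)

lemma cover_in_annulus_iff: "cover z \<in> annulus \<longleftrightarrow> z \<in> strip"
  by (auto simp: cover_def annulus_def strip_def mem_Times_iff)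

definition uncover :: "circle \<times> real \<Rightarrow> real \<times> real"
  where "uncover p = (rep_circle (fst p), snd p)"

lemma cover_uncover: "cover (uncover p) = p"
  by (simp add: cover_def uncover_def Quotient_abs_rep[OF Quotient_circle])

lemma uncover_in_strip: "p \<in> annulus \<Longrightarrow> uncover p \<in> strip"
  using cover_in_annulus_iff[of "uncover p"] by (simp add: cover_uncover)

text \<open>The value is computed at the representative chosen by \<open>uncover\<close>, so
  \<open>F\<close> is a lift once it respects the fibres of \<open>cover\<close>. The restriction
  makes the map extensional, as \<open>Diff\<close> demands.\<close>

definition descend :: "(real \<times> real \<Rightarrow> real \<times> real) \<Rightarrow> circle \<times> real \<Rightarrow> circle \<times> real"
  where "descend F = restrict (\<lambda>p. cover (F (uncover p))) annulus"

lemma is_lift_descend: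
  assumes "\<And>z w. cover z = cover w \<Longrightarrow> cover (F z) = cover (F w)"
  shows "is_lift F (descend F)"
  unfolding is_lift_def descend_def
  using assms[of "uncover (cover _)"] by (auto simp: cover_uncover cover_in_annulus_iff)

text \<open>The inverse lift \<open>K\<close> descends to the inverse on the annulus, which supplies
  the lift of the inverse that \<open>Diff\<close> asks for.\<close>

lemma descend_in_Diff:
  assumes F: "Cr_on r strip F" "\<And>z. z \<in> strip \<Longrightarrow> F z \<in> strip"
      "\<And>z w. cover z = cover w \<Longrightarrow> cover (F z) = cover (F w)"
    and K: "Cr_on r strip K" "\<And>z. z \<in> strip \<Longrightarrow> K z \<in> strip"
      "\<And>z w. cover z = cover w \<Longrightarrow> cover (K z) = cover (K w)"
    and FK: "\<And>z. F (K z) = z" "\<And>z. K (F z) = z"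
  shows "descend F \<in> Diff r"
proof -
  have FK': "descend F (descend K p) = p" "descend K (descend F p) = p"
    "descend F p \<in> annulus" "descend K p \<in> annulus" if p: "p \<in> annulus" for p
  proof -
    obtain z where z: "z \<in> strip" "p = cover z"
      using uncover_in_strip[OF p] cover_uncover[of p] by metis
    have Fz: "descend F (cover w) = cover (F w)" "descend K (cover w) = cover (K w)" if "w \<in> strip" for w
      using is_lift_descend[of F, OF F(3)] is_lift_descend[of K, OF K(3)] that by (auto simp: is_lift_def)
    show "descend F (descend K p) = p" "descend K (descend F p) = p"
      "descend F p \<in> annulus" "descend K p \<in> annulus"
      using z F(2) K(2) FK by (simp_all add: Fz cover_in_annulus_iff)
  qed
  then have bij: "bij_betw (descend F) annulus annulus"
    by (intro bij_betw_byWitness[where f' = "descend K"]) auto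
  have "inv_into annulus (descend F) p = descend K p" if "p \<in> annulus" for p
    using FK' bij that by (intro inv_into_f_eq) (auto simp: bij_betw_def)
  then have "is_lift K (inv_into annulus (descend F))"
    using is_lift_descend[of K, OF K(3)] by (simp add: is_lift_def cover_in_annulus_iff)
  then have "Cr_map r (inv_into annulus (descend F))"
    using K(1) by (auto simp: Cr_map_def)
  moreover have "Cr_map r (descend F)"
    using F(1) is_lift_descend[of F, OF F(3)] by (auto simp: Cr_map_def)
  ultimately show ?thesis
    using bij by (simp add: Diff_def descend_def)
qed

section \<open>The model maps and their isotopy to the identity\<close>

definition model_lift :: "real \<Rightarrow> real \<times> real \<Rightarrow> real \<times> real"
  where "model_lift a = prod_map (sine_map (2 * pi) a) (sine_map pi a)"

definition model :: "real \<Rightarrow> circle \<times> real \<Rightarrow> circle \<times> real"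
  where "model a = descend (model_lift a)"

lemma cover_add_int: "cover (x + of_int k, y) = cover (x, y)"
  by (simp add: cover_eq_iff)

lemma cover_eqE:
  assumes "cover z = cover w"
  obtains k :: int where "z = (fst w + of_int k, snd w)"
proof -
  obtain k where "fst z - fst w = of_int k"
    using assms by (auto simp: cover_eq_iff elim: Ints_cases)
  then show ?thesis
    using assms cover_eq_iff[of z w] by (intro that[of k]) (auto simp: prod_eq_iff)
qed

lemma sine_map_add_int: "sine_map (2 * pi) a (x + of_int k) = sine_map (2 * pi) a x + of_int k"
  by (rule sine_map_add) (auto simp: sin_int_2pin cos_int_2pin)

lemma cover_model_lift: "cover z = cover w \<Longrightarrow> cover (model_lift a z) = cover (model_lift a w)"
  by (erule cover_eqE) (simp add: model_lift_def prod_map_def sine_map_add_int cover_add_int)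

lemma is_lift_model: "is_lift (model_lift a) (model a)"
  unfolding model_def by (intro is_lift_descend cover_model_lift)

lemma model_cover: "z \<in> strip \<Longrightarrow> model a (cover z) = cover (model_lift a z)"
  using is_lift_model by (simp add: is_lift_def)

lemma sine_map_in_unit:
  assumes "\<bar>a\<bar> < 1"
  shows "sine_map pi a y \<in> {0..1} \<longleftrightarrow> y \<in> {0..1}"
proof -
  have "sine_map pi a 0 = 0" "sine_map pi a 1 = 1"
    by (simp_all add: sine_map_def)
  then show ?thesis
    using strict_mono_less_eq[OF strict_mono_sine_map[of pi a], of 0 y]
      strict_mono_less_eq[OF strict_mono_sine_map[of pi a], of y 1] assms by auto
qed

lemma model_lift_in_strip: "\<bar>a\<bar> < 1 \<Longrightarrow> model_lift a z \<in> strip \<longleftrightarrow> z \<in> strip"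
  using sine_map_in_unit[of a "snd z"] by (simp add: model_lift_def prod_map_def strip_def mem_Times_iff)

lemma sine_map_in_affine_trig: "b \<noteq> 0 \<Longrightarrow> sine_map b a \<in> affine_trig b"
  by (rule affine_trigI[where l = 1 and m = 0 and p = "a / b" and q = 0]) (auto simp: sine_map_def)

lemma zero_in_affine_trig: "(\<lambda>_. 0) \<in> affine_trig b"
  by (rule affine_trigI[where l = 0 and m = 0 and p = 0 and q = 0]) auto

lemma Cr_on_model_lift: "Cr_on r strip (model_lift a)"
  unfolding model_lift_def
  by (rule Cr_on_prod_map[of "affine_trig (2 * pi)" "affine_trig pi"])
    (auto simp: deriv_closed_affine_trig zero_in_affine_trig sine_map_in_affine_trig)

lemma model_in_Diff:
  assumes "\<bar>a\<bar> < 1"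
  shows "model a \<in> Diff r"
  unfolding model_def
proof (rule descend_in_Diff)
  define K where "K = prod_map (inv (sine_map (2 * pi) a)) (inv (sine_map pi a))"
  have zero: "(\<lambda>_. 0) \<in> (\<lambda>r x. r (inv (sine_map b a) x)) ` cos_alg b a" for b
    using cos_alg.const[of 0] by (intro image_eqI[where x = "\<lambda>_. 0"]) auto
  have inv: "inv (sine_map b a) \<in> (\<lambda>r x. r (inv (sine_map b a) x)) ` cos_alg b a" for b
    using cos_alg.ident by (intro image_eqI[where x = "\<lambda>x. x"]) auto
  show "Cr_on r strip K"
    unfolding K_def using assms
    by (intro Cr_on_prod_map[OF _ _ zero zero inv inv] deriv_closed_inv_sine_map) auto
  have bij: "bij (sine_map (2 * pi) a)" "bij (sine_map pi a)"
    using assms by (auto intro: bij_sine_map)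
  show FK: "model_lift a (K z) = z" "K (model_lift a z) = z" for z
    using bij by (simp_all add: model_lift_def K_def prod_map_def bij_is_surj surj_f_inv_f bij_is_inj)
  show "K z \<in> strip" if "z \<in> strip" for z
    using that model_lift_in_strip[OF assms, of "K z"] FK by simp
  show "cover (K z) = cover (K w)" if zw: "cover z = cover w" for z w
  proof -
    obtain k :: int where k: "z = (fst w + of_int k, snd w)"
      using zw by (rule cover_eqE)
    \<comment> \<open>Compatibility of \<open>K\<close> with integer translations is read off from
      that of \<open>model_lift a\<close>: both candidates for \<open>K z\<close> have the same
      image.\<close>
    have "z = model_lift a (fst (K w) + of_int k, snd (K w))"
      using arg_cong[OF FK(1)[of w], of fst] arg_cong[OF FK(1)[of w], of snd] k
      by (simp add: model_lift_def prod_map_def sine_map_add_int)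
    then have "K z = (fst (K w) + of_int k, snd (K w))"
      using FK(2) by metis
    then show ?thesis
      using cover_add_int[of "fst (K w)" k "snd (K w)"] by simp
  qed
  show "Cr_on r strip (model_lift a)"
    by (rule Cr_on_model_lift)
  show "model_lift a z \<in> strip" if "z \<in> strip" for z
    using that assms by (simp add: model_lift_in_strip)
  show "cover (model_lift a z) = cover (model_lift a w)" if "cover z = cover w" for z w
    using that by (rule cover_model_lift)
qed

lemma model_zero: "model 0 = id_annulus"
  by (rule ext) (auto simp: model_def descend_def model_lift_def prod_map_def sine_map_def id_annulus_def
      cover_uncover)

text \<open>The lift is affine in its parameter, so two lifts differ by a multiple of one fixed
  product map.\<close>

lemma partials_model_lift_diff:
  assumes "set vs \<subseteq> Basis" "z \<in> strip"
  shows "partials strip vs (model_lift a) z - partials strip vs (model_lift a') z =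
    (a - a') *\<^sub>R partials strip vs (prod_map (\<lambda>x. sin (2 * pi * x) / (2 * pi)) (\<lambda>x. sin (pi * x) / pi)) z"
proof -
  define w :: "real \<Rightarrow> real \<Rightarrow> real" where "w b x = sin (b * x) / b" for b x
  have "w b \<in> affine_trig b" for b
    by (rule affine_trigI[where l = 0 and m = 0 and p = "1 / b" and q = 0]) (auto simp: w_def)
  then have diff: "partials strip ws (prod_map (w (2 * pi)) (w pi)) differentiable_on strip"
      "partials strip ws (model_lift a) differentiable_on strip"
      if "set ws \<subseteq> Basis" for ws a
    unfolding model_lift_def using that
    by (intro partials_prod_map_differentiable_on[of "affine_trig (2 * pi)" "affine_trig pi"];
        auto simp: deriv_closed_affine_trig zero_in_affine_trig sine_map_in_affine_trig)+
  have "model_lift a = (\<lambda>x. model_lift a' x + (a - a') *\<^sub>R prod_map (w (2 * pi)) (w pi) x)"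
    by (rule ext) (auto simp: model_lift_def prod_map_def sine_map_def w_def algebra_simps
        diff_divide_distrib add_divide_distrib)
  then show ?thesis
    using partials_strip_add_scaleR[OF diff(2) diff(1) assms, of a' "a - a'"]
    by (simp add: w_def[abs_def])
qed

lemma bounded_trig:
  assumes "u \<in> trig b"
  shows "\<exists>M. \<forall>x. \<bar>u x\<bar> \<le> M"
proof -
  obtain m p q where u: "u = (\<lambda>x. m + p * sin (b * x) + q * cos (b * x))"
    using assms unfolding trig_def by blast
  have "\<bar>p * sin (b * x)\<bar> \<le> \<bar>p\<bar>" "\<bar>q * cos (b * x)\<bar> \<le> \<bar>q\<bar>" for x
    by (simp_all add: abs_mult mult_left_le)
  then have "\<bar>u x\<bar> \<le> \<bar>m\<bar> + \<bar>p\<bar> + \<bar>q\<bar>" for x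
    unfolding u by (intro order_trans[OF abs_triangle_ineq] add_mono order_refl)
  then show ?thesis by blast
qed

lemma bounded_partials_trig:
  assumes "u \<in> trig b" "v \<in> trig c"
  shows "\<exists>M>0. \<forall>vs z. set vs \<subseteq> Basis \<and> length vs \<le> k \<and> z \<in> strip \<longrightarrow>
    norm (partials strip vs (prod_map u v) z) \<le> M"
proof -
  have zero: "(\<lambda>_. 0) \<in> trig b" for b
    by (rule trigI[where m = 0 and p = 0 and q = 0]) auto
  have "\<exists>M. \<forall>z\<in>strip. norm (partials strip vs (prod_map u v) z) \<le> M" if vs: "set vs \<subseteq> Basis" for vs
  proof -
    obtain u1 v1 where uv: "u1 \<in> trig b" "v1 \<in> trig c"
      and eq: "\<And>z. z \<in> strip \<Longrightarrow> partials strip vs (prod_map u v) z = prod_map u1 v1 z"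
      using partials_prod_map[OF deriv_closed_trig deriv_closed_trig zero zero assms vs] by blast
    obtain M N where MN: "\<And>x. \<bar>u1 x\<bar> \<le> M" "\<And>x. \<bar>v1 x\<bar> \<le> N"
      using bounded_trig[OF uv(1)] bounded_trig[OF uv(2)] by blast
    have "norm (partials strip vs (prod_map u v) z) \<le> M + N" if "z \<in> strip" for z
      using norm_Pair_le[of "u1 (fst z)" "v1 (snd z)"] MN(1)[of "fst z"] MN(2)[of "snd z"]
      by (simp add: eq[OF that] prod_map_def)
    then show ?thesis by blast
  qed
  then obtain M where M: "\<And>vs z. set vs \<subseteq> Basis \<Longrightarrow> z \<in> strip \<Longrightarrow>
      norm (partials strip vs (prod_map u v) z) \<le> M vs"
    by metis
  \<comment> \<open>There are only finitely many lists of directions of length at most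
    \<open>k\<close>, so the sum of their bounds is a common bound; adding 1 makes it
    positive.\<close>
  define V where "V = {vs. set vs \<subseteq> (Basis :: (real \<times> real) set) \<and> length vs \<le> k}"
  have "finite V"
    unfolding V_def by (intro finite_lists_length_le) simp
  then have "M vs \<le> 1 + (\<Sum>vs\<in>V. \<bar>M vs\<bar>)" if "vs \<in> V" for vs
    using member_le_sum[OF that, of "\<lambda>vs. \<bar>M vs\<bar>"] by auto
  then have "norm (partials strip vs (prod_map u v) z) \<le> 1 + (\<Sum>vs\<in>V. \<bar>M vs\<bar>)"
    if "set vs \<subseteq> Basis \<and> length vs \<le> k \<and> z \<in> strip" for vs z
    using M[of vs z] that by (force simp: V_def intro: order_trans)
  moreover have "0 < 1 + (\<Sum>vs\<in>V. \<bar>M vs\<bar>)"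
    by (smt (verit) sum_nonneg)
  ultimately show ?thesis by blast
qed

text \<open>Changing the parameter from \<open>a\<close> to \<open>a'\<close> moves each partial of
  order at most \<open>k\<close> by at most \<open>\<bar>a - a'\<bar> * M\<close>, with
  \<open>M\<close> independent of both parameters.\<close>

lemma continuous_map_model:
  assumes "A \<subseteq> {-1<..<1}"
  shows "continuous_map (top_of_set A) (Cr_topology \<infinity>) model"
  unfolding continuous_map_def topspace_Cr_topology openin_Cr_topology
proof (intro conjI allI impI)
  have abs: "\<bar>a\<bar> < 1" if "a \<in> A" for a
    using assms that by (auto simp: abs_less_iff)
  show "model \<in> topspace (top_of_set A) \<rightarrow> Diff \<infinity>"
    using model_in_Diff abs by auto
  fix W assume W: "Cr_open \<infinity> W"
  have "\<exists>d>0. \<forall>a'\<in>A. dist a' a < d \<longrightarrow> model a' \<in> W" if a: "a \<in> A" "model a \<in> W" for a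
  proof -
    obtain k e where e: "0 < e" "Cr_nbhd \<infinity> k e (model a) \<subseteq> W"
      using W a unfolding Cr_open_def by blast
    let ?B = "prod_map (\<lambda>x. sin (2 * pi * x) / (2 * pi)) (\<lambda>x. sin (pi * x) / pi)"
    have "(\<lambda>x. sin (b * x) / b) \<in> trig b" for b
      by (rule trigI[where m = 0 and p = "1 / b" and q = 0]) auto
    from bounded_partials_trig[OF this this, of k "2 * pi" pi]
    obtain M where "0 < M" and M: "\<And>vs z. set vs \<subseteq> Basis \<Longrightarrow> length vs \<le> k \<Longrightarrow> z \<in> strip \<Longrightarrow>
        norm (partials strip vs ?B z) \<le> M"
      by blast
    have "model a' \<in> W" if a': "a' \<in> A" "dist a' a < e / M" for a'
    proof -
      have "norm (partials strip vs (model_lift a) z - partials strip vs (model_lift a') z) < e"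
        if "set vs \<subseteq> Basis \<and> length vs \<le> k" "z \<in> strip" for vs z
      proof -
        have "norm (partials strip vs (model_lift a) z - partials strip vs (model_lift a') z) \<le> \<bar>a - a'\<bar> * M"
          using that M[of vs z] by (simp add: partials_model_lift_diff mult_left_mono)
        also have "\<dots> < e"
          using a'(2) \<open>0 < M\<close> by (simp add: dist_real_def pos_less_divide_eq abs_minus_commute)
        finally show ?thesis .
      qed
      then have "model a' \<in> Cr_nbhd \<infinity> k e (model a)"
        unfolding Cr_nbhd_def
        using model_in_Diff[OF abs[OF a'(1)]] Cr_on_model_lift is_lift_model by blast
      with e show ?thesis by blast
    qed
    with \<open>0 < M\<close> \<open>0 < e\<close> show ?thesis
      by (intro exI[of _ "e / M"]) auto
  qed
  then show "openin (top_of_set A) {a \<in> topspace (top_of_set A). model a \<in> W}"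
    unfolding openin_euclidean_subtopology_iff by auto
qed

text \<open>The models form a continuous image of an interval, and the parameter 0 gives the
  identity.\<close>

lemma model_in_Diff0:
  assumes "\<bar>a\<bar> < 1"
  shows "model a \<in> Diff0 \<infinity>"
proof -
  have "connectedin (Cr_topology \<infinity>) (model ` {-1<..<1})"
    by (rule connectedin_continuous_map_image[OF continuous_map_model])
      (auto simp: connectedin_subtopology)
  moreover have "id_annulus \<in> model ` {-1<..<1}"
    by (rule image_eqI[where x = 0]) (simp_all add: model_zero)
  moreover have "model a \<in> model ` {-1<..<1}"
    using assms by (auto simp: abs_less_iff)
  ultimately show ?thesis
    unfolding Diff0_def connected_component_of_def by blast
qed

section \<open>Multipliers of periodic points of circle maps\<close>

lemma funpow_add_int:
  fixes \<phi> :: "real \<Rightarrow> real"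
  assumes "\<And>t. \<phi> (t + 1) = \<phi> t + 1"
  shows "(\<phi> ^^ n) (t + of_int k) = (\<phi> ^^ n) t + of_int k"
proof -
  have nat: "\<phi> (t + of_nat k) = \<phi> t + of_nat k" for t k
    by (induction k) (simp_all add: assms[of "t + of_nat _", simplified add.assoc] add.assoc add.commute[of 1])
  have int: "\<phi> (t + of_int k) = \<phi> t + of_int k" for t k
    using nat[of t "nat k"] nat[of "t + of_int k" "nat (- k)"] by (cases "0 \<le> k") auto
  show ?thesis
    by (induction n) (simp_all add: int)
qed

lemma funpow_has_real_derivative:
  fixes \<phi> \<phi>' :: "real \<Rightarrow> real"
  assumes "\<And>t. (\<phi> has_real_derivative \<phi>' t) (at t)"
  shows "((\<phi> ^^ n) has_real_derivative (\<Prod>i<n. \<phi>' ((\<phi> ^^ i) t))) (at t)"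
proof (induction n)
  case (Suc n)
  from DERIV_chain[OF assms this] show ?case
    by (simp add: o_def mult.commute)
qed (simp add: id_def)

text \<open>Lebesgue measure is additive on the disjoint open intervals, whose union lies in
  \<open>{c..d}\<close>.\<close>

lemma sum_lengths_le:
  fixes a b :: "nat \<Rightarrow> real"
  assumes le: "\<And>i. i < m \<Longrightarrow> a i \<le> b i"
    and sub: "\<And>i. i < m \<Longrightarrow> c \<le> a i \<and> b i \<le> d"
    and disj: "\<And>i j. i < m \<Longrightarrow> j < m \<Longrightarrow> i \<noteq> j \<Longrightarrow> {a i<..<b i} \<inter> {a j<..<b j} = {}"
    and "c \<le> d"
  shows "(\<Sum>i<m. b i - a i) \<le> d - c"
proof -
  have "(\<Sum>i<m. b i - a i) = (\<Sum>i<m. measure lborel {a i<..<b i})"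
    using le by (intro sum.cong) auto
  also have "\<dots> = measure lborel (\<Union>i<m. {a i<..<b i})"
    using disj le
    by (intro measure_finite_Union[symmetric]) (auto simp: disjoint_family_on_def)
  also have "\<dots> \<le> measure lborel {c..d}"
    using sub by (intro measure_mono_fmeasurable) (auto intro: fmeasurable_cbox[of c d, simplified], fastforce+)
  also have "\<dots> = d - c"
    using \<open>c \<le> d\<close> by simp
  finally show ?thesis .
qed

text \<open>The gaps of a periodic orbit are permuted by the map, so their images have total length at
  most one; by the mean value theorem the multiplier equals 1 somewhere in each gap.\<close>

lemma periodic_multiplier_bound:
  fixes \<phi> \<phi>' :: "real \<Rightarrow> real"
  assumes deg: "\<And>t. \<phi> (t + 1) = \<phi> t + 1"
    and deriv: "\<And>t. (\<phi> has_real_derivative \<phi>' t) (at t)"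
    and pos: "\<And>t. 0 < \<phi>' t"
    and lip: "\<And>s t. \<bar>ln (\<phi>' s) - ln (\<phi>' t)\<bar> \<le> L * \<bar>s - t\<bar>"
    and m: "0 < m" "(\<phi> ^^ m) x = x + of_int p"
    and min: "\<And>n. 0 < n \<Longrightarrow> n < m \<Longrightarrow> (\<phi> ^^ n) x - x \<notin> \<int>"
  shows "\<bar>ln (\<Prod>i<m. \<phi>' ((\<phi> ^^ i) x))\<bar> \<le> L"
proof -
  note shift = funpow_add_int[of \<phi>, OF deg]
  have less: "\<phi> s < \<phi> t" if "s < t" for s t
    using that deriv pos by (intro DERIV_pos_imp_increasing[of s t \<phi>]) auto
  have iter_less: "(\<phi> ^^ n) s < (\<phi> ^^ n) t" if "s < t" for s t n
    using that by (induction n) (auto intro: less)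
  have iter_less_iff: "(\<phi> ^^ n) s < (\<phi> ^^ n) t \<longleftrightarrow> s < t" for s t n
    using iter_less[of s t n] iter_less[of t s n] by (metis less_asym linorder_cases)
  \<comment> \<open>This is the full preimage on the line of the periodic orbit on the
    circle.\<close>
  define Orb where "Orb = {(\<phi> ^^ i) x + of_int k | i k. True}"
  have Orb_I: "(\<phi> ^^ i) x + of_int k \<in> Orb" for i k
    unfolding Orb_def by blast
  have Orb_shift: "z + of_int k \<in> Orb" if "z \<in> Orb" for z k
    using that Orb_I by (auto simp: Orb_def) (metis add.assoc of_int_add)
  have xm: "(\<phi> ^^ m) ((\<phi> ^^ i) x + of_int k) = (\<phi> ^^ i) x + of_int k + of_int p" for i k
  proof -
    have "(\<phi> ^^ m) ((\<phi> ^^ i) x) = (\<phi> ^^ i) ((\<phi> ^^ m) x)"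
      by (metis add.commute comp_apply funpow_add)
    then show ?thesis
      by (simp add: shift m(2))
  qed
  \<comment> \<open>Since \<open>\<phi> ^^ m\<close> translates the orbit by \<open>p\<close>, a
    preimage is found by applying \<open>\<phi>\<close> another \<open>m - 1\<close> times and
    translating back by \<open>p\<close>.\<close>
  have Orb_back1: "\<exists>w\<in>Orb. z = \<phi> w" if z_Orb: "z \<in> Orb" for z
  proof -
    obtain i k where z: "z = (\<phi> ^^ i) x + of_int k"
      using z_Orb unfolding Orb_def by blast
    have "z = (\<phi> ^^ m) ((\<phi> ^^ i) x + of_int (k - p))"
      unfolding xm z by simp
    also have "\<dots> = \<phi> ((\<phi> ^^ (m - 1)) ((\<phi> ^^ i) x + of_int (k - p)))"
      using m(1) by (cases m) auto
    also have "(\<phi> ^^ (m - 1)) ((\<phi> ^^ i) x + of_int (k - p)) = (\<phi> ^^ (m - 1 + i)) x + of_int (k - p)"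
      by (simp only: shift funpow_add o_apply)
    finally show ?thesis using Orb_I by blast
  qed
  have Orb_back: "\<exists>w\<in>Orb. z = (\<phi> ^^ n) w" if "z \<in> Orb" for z n
    using that
  proof (induction n arbitrary: z)
    case (Suc n)
    then show ?case
      using Orb_back1[of z] by fastforce
  qed simp
  \<comment> \<open>Reducing the exponent modulo \<open>m\<close> leaves finitely many orbit points
    in each bounded interval.\<close>
  have Orb_mod: "\<exists>j<m. \<exists>k. z = (\<phi> ^^ j) x + of_int k" if z_Orb: "z \<in> Orb" for z
  proof -
    have mult: "\<exists>l::int. (\<phi> ^^ (m * q)) x = x + of_int l" for q
    proof (induction q)
      case (Suc q)
      then obtain l :: int where "(\<phi> ^^ (m * q)) x = x + of_int l" by blast
      then have "(\<phi> ^^ (m * Suc q)) x = x + of_int (p + l)"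
        by (simp add: funpow_add shift m(2))
      then show ?case by blast
    qed (auto intro: exI[of _ 0])
    obtain i k where z: "z = (\<phi> ^^ i) x + of_int k"
      using z_Orb unfolding Orb_def by blast
    obtain l :: int where l: "(\<phi> ^^ (m * (i div m))) x = x + of_int l"
      using mult by blast
    have "(\<phi> ^^ i) x = (\<phi> ^^ (i mod m)) ((\<phi> ^^ (m * (i div m))) x)"
      by (metis comp_apply funpow_add mod_mult_div_eq)
    then have "z = (\<phi> ^^ (i mod m)) x + of_int (l + k)"
      by (simp add: z l shift)
    then show ?thesis
      using m(1) mod_less_divisor by blast
  qed
  have fin: "finite (Orb \<inter> {x<..x + 1})"
  proof (rule finite_subset)
    show "Orb \<inter> {x<..x + 1} \<subseteq> (\<Union>j<m. (\<lambda>k. (\<phi> ^^ j) x + of_int k) ` {\<lfloor>x - (\<phi> ^^ j) x\<rfloor>..\<lceil>x + 1 - (\<phi> ^^ j) x\<rceil>})"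
    proof
      fix z assume z: "z \<in> Orb \<inter> {x<..x + 1}"
      then obtain j and k :: int where jk: "j < m" "z = (\<phi> ^^ j) x + of_int k"
        using Orb_mod by blast
      have "\<lfloor>x - (\<phi> ^^ j) x\<rfloor> \<le> k" "k \<le> \<lceil>x + 1 - (\<phi> ^^ j) x\<rceil>"
        using z jk by (auto simp: floor_le_iff le_ceiling_iff)
      with jk show "z \<in> (\<Union>j<m. (\<lambda>k. (\<phi> ^^ j) x + of_int k) ` {\<lfloor>x - (\<phi> ^^ j) x\<rfloor>..\<lceil>x + 1 - (\<phi> ^^ j) x\<rceil>})"
        by (intro UN_I[of j] image_eqI[of _ _ k]) auto
    qed
  qed auto
  have x1: "x + 1 \<in> Orb \<inter> {x<..x + 1}"
    using Orb_I[of 0 1] by simp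
  \<comment> \<open>The orbit point next to \<open>x\<close> on the right; it exists because
    \<open>x + 1\<close> also belongs to the orbit.\<close>
  define y where "y = Min (Orb \<inter> {x<..x + 1})"
  have "y \<in> Orb \<inter> {x<..x + 1}"
    unfolding y_def using x1 by (intro Min_in fin) blast
  then have y: "y \<in> Orb" "x < y" by auto
  have gap: "\<not> (x < z \<and> z < y)" if "z \<in> Orb" for z
  proof
    assume z: "x < z \<and> z < y"
    have "y \<le> x + 1"
      using Min_le[OF fin x1] by (simp add: y_def)
    with z that have "z \<in> Orb \<inter> {x<..x + 1}" by auto
    from Min_le[OF fin this] z show False by (simp add: y_def)
  qed
  have gap_n: "\<not> ((\<phi> ^^ n) x + of_int k < z \<and> z < (\<phi> ^^ n) y + of_int k)" if z_Orb: "z \<in> Orb" for z n k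
  proof
    assume z: "(\<phi> ^^ n) x + of_int k < z \<and> z < (\<phi> ^^ n) y + of_int k"
    obtain w where w: "w \<in> Orb" "z - of_int k = (\<phi> ^^ n) w"
      using Orb_back[of "z - of_int k" n] Orb_shift[OF z_Orb, of "- k"] by auto
    have "(\<phi> ^^ n) x < (\<phi> ^^ n) w" "(\<phi> ^^ n) w < (\<phi> ^^ n) y"
      using z w(2) by auto
    then show False
      using gap[OF w(1)] by (simp add: iter_less_iff)
  qed
  \<comment> \<open>The translation by \<open>k i\<close> brings the left end of the
    \<open>i\<close>-th image of the gap into \<open>[x, x + 1)\<close>.\<close>
  define k where "k i = - \<lfloor>(\<phi> ^^ i) x - x\<rfloor>" for i
  define a b where "a i = (\<phi> ^^ i) x + of_int (k i)" and "b i = (\<phi> ^^ i) y + of_int (k i)" for i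
  have a_bounds: "x \<le> a i" "a i < x + 1" for i
    unfolding a_def k_def of_int_minus using floor_correct[of "(\<phi> ^^ i) x - x"] by linarith+
  have ab: "a i < b i" for i
    unfolding a_def b_def using iter_less[OF y(2)] by simp
  have a_Orb: "a i \<in> Orb" for i
    unfolding a_def by (rule Orb_I)
  have b_gap: "\<not> (a i < z \<and> z < b i)" if "z \<in> Orb" for z i
    unfolding a_def b_def by (rule gap_n[OF that])
  have a_inj: "a i \<noteq> a j" if "i < j" "j < m" for i j
  proof
    assume "a i = a j"
    then have "(\<phi> ^^ i) ((\<phi> ^^ (j - i)) x) = (\<phi> ^^ i) (x + of_int (k i - k j))"
      using that funpow_add[of i "j - i" \<phi>] shift[of i x "k i - k j"] by (simp add: a_def)
    then have "(\<phi> ^^ (j - i)) x = x + of_int (k i - k j)"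
      using iter_less_iff by (metis less_irrefl linorder_cases)
    then have "(\<phi> ^^ (j - i)) x - x \<in> \<int>"
      by simp
    moreover have "0 < j - i" "j - i < m"
      using that by auto
    ultimately show False
      using min by blast
  qed
  \<comment> \<open>No gap contains an orbit point. As \<open>x + 1\<close> is one, every translated
    gap ends by \<open>x + 1\<close>; as the left ends are distinct orbit points, the gaps are
    disjoint.\<close>
  have sum1: "(\<Sum>i<m. b i - a i) \<le> (x + 1) - x"
  proof (rule sum_lengths_le)
    show "a i \<le> b i" "x \<le> a i \<and> b i \<le> x + 1" for i
      using ab[of i] a_bounds[of i] b_gap[of "x + 1" i] x1 by auto
    show "{a i<..<b i} \<inter> {a j<..<b j} = {}" if ij: "i < m" "j < m" "i \<noteq> j" for i j
    proof -
      have "a i \<noteq> a j"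
        using ij a_inj[of i j] a_inj[of j i] by (metis linorder_neqE_nat)
      then show ?thesis
        using b_gap[OF a_Orb, of i j] b_gap[OF a_Orb, of j i]
        by (force simp: not_less dest: order.strict_trans)
    qed
  qed simp
  define P where "P t = (\<Prod>i<m. \<phi>' ((\<phi> ^^ i) t))" for t
  obtain i0 k0 where i0: "y = (\<phi> ^^ i0) x + of_int k0"
    using y(1) unfolding Orb_def by blast
  have ym: "(\<phi> ^^ m) y = y + of_int p"
    using xm i0 by simp
  \<comment> \<open>Both ends of the gap are translated by \<open>p\<close>, so the mean slope of
    \<open>\<phi> ^^ m\<close> on it is 1.\<close>
  obtain \<xi> where \<xi>: "x < \<xi>" "\<xi> < y" "(\<phi> ^^ m) y - (\<phi> ^^ m) x = (y - x) * P \<xi>"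
    using MVT2[OF y(2), of "\<phi> ^^ m" P] funpow_has_real_derivative[of \<phi>, OF deriv]
    unfolding P_def by blast
  have "P \<xi> = 1"
    using \<xi>(3) y(2) by (simp add: ym m(2))
  have ln_P: "ln (P t) = (\<Sum>i<m. ln (\<phi>' ((\<phi> ^^ i) t)))" for t
    unfolding P_def using pos by (intro ln_prod) (auto simp: less_imp_neq[symmetric])
  have L: "0 \<le> L"
    using lip[of 1 0] by simp
  \<comment> \<open>Subtracting \<open>ln (P \<xi>) = 0\<close> turns the logarithm of the
    multiplier into a sum of variations of \<open>ln \<phi>'\<close> over the images of the
    gap.\<close>
  have "ln (P x) = (\<Sum>i<m. ln (\<phi>' ((\<phi> ^^ i) x)) - ln (\<phi>' ((\<phi> ^^ i) \<xi>)))"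
    using ln_P[of x] ln_P[of \<xi>] \<open>P \<xi> = 1\<close> by (simp add: sum_subtractf)
  also have "\<bar>\<dots>\<bar> \<le> (\<Sum>i<m. L * (b i - a i))"
  proof (rule order_trans[OF sum_abs sum_mono])
    fix i
    have "\<bar>ln (\<phi>' ((\<phi> ^^ i) x)) - ln (\<phi>' ((\<phi> ^^ i) \<xi>))\<bar> \<le> L * \<bar>(\<phi> ^^ i) x - (\<phi> ^^ i) \<xi>\<bar>"
      by (rule lip)
    also have "\<dots> \<le> L * (b i - a i)"
      using L iter_less[OF \<xi>(1), of i] iter_less[OF \<xi>(2), of i]
      by (intro mult_left_mono) (auto simp: a_def b_def)
    finally show "\<bar>ln (\<phi>' ((\<phi> ^^ i) x)) - ln (\<phi>' ((\<phi> ^^ i) \<xi>))\<bar> \<le> L * (b i - a i)" .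
  qed
  also have "\<dots> = L * (\<Sum>i<m. b i - a i)"
    by (simp add: sum_distrib_left)
  also have "\<dots> \<le> L * 1"
    using sum1 by (intro mult_left_mono L) simp
  finally show ?thesis
    by (simp add: P_def)
qed

section \<open>Recurrent points of circle maps\<close>

text \<open>A Baire argument for finitely many locally closed sets: on a relatively open piece of a minimal
  set which meets as few as possible of the preimages of \<open>D\<close>, each of those it meets is dense, hence
  contains a smaller piece.\<close>

lemma ex_recurrent_point:
  fixes \<phi> :: "real \<Rightarrow> real" and D :: "real set"
  assumes cont: "\<And>t. isCont \<phi> t"
    and deg: "\<And>t. \<phi> (t + 1) = \<phi> t + 1"
    and locally_closed: "\<And>t. t \<in> D \<Longrightarrow> \<exists>U C. open U \<and> t \<in> U \<and> closed C \<and> U \<inter> D = U \<inter> C"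
    and hit: "\<And>t. \<exists>n\<le>N. (\<phi> ^^ n) t \<in> D"
  shows "\<exists>s\<in>D. \<forall>e>0. \<forall>M. \<exists>n\<ge>M. \<exists>k::int.
    (\<phi> ^^ n) s + of_int k \<in> D \<and> \<bar>(\<phi> ^^ n) s + of_int k - s\<bar> < e"
proof -
  note shift = funpow_add_int[of \<phi>, OF deg]
  have cont_n: "isCont (\<phi> ^^ n) t" for n t
  proof (induction n arbitrary: t)
    case (Suc n)
    then show ?case
      using isCont_o2[OF Suc cont] by (simp add: o_def)
  qed (simp add: id_def)
  \<comment> \<open>Closed sets with this property are the preimages of nonempty closed forward
    invariant sets of the circle. Meeting \<open>{0..1}\<close> expresses nonemptiness in a form
    that compactness carries to nested intersections.\<close>
  define \<psi> where "\<psi> K \<longleftrightarrow> K \<inter> {0..1} \<noteq> {} \<and> (\<forall>t\<in>K. \<forall>k::int. t + of_int k \<in> K) \<and> (\<forall>t\<in>K. \<phi> t \<in> K)" for K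
  obtain K where K: "closed K" "\<psi> K" and K_min: "\<And>E. closed E \<Longrightarrow> \<psi> E \<Longrightarrow> \<not> E \<subset> K"
  proof (rule Brouwer_reduction_theorem_gen[of UNIV \<psi>])
    fix F :: "nat \<Rightarrow> real set"
    assume F: "\<And>n. closed (F n)" "\<And>n. \<psi> (F n)" "\<And>n. F (Suc n) \<subseteq> F n"
    have "\<Inter> (range (\<lambda>n. F n \<inter> {0..1})) \<noteq> {}"
    proof (rule compact_nest)
      show "compact (F n \<inter> {0..1})" for n
        using F(1) by (simp add: closed_Int_compact)
      show "F n \<inter> {0..1} \<noteq> {}" for n
        using F(2) by (simp add: \<psi>_def)
      show "F n \<inter> {0..1} \<subseteq> F m \<inter> {0..1}" if "m \<le> n" for m n
        using lift_Suc_antimono_le[of F, OF F(3) that] by auto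
    qed
    then show "\<psi> (\<Inter> (range F))"
      using F(2) unfolding \<psi>_def by auto
  next
    have "(0 :: real) \<in> {0..1}" by simp
    then show "\<psi> UNIV" unfolding \<psi>_def by blast
  qed (auto simp: that)
  have iter_K: "(\<phi> ^^ n) t \<in> K" if "t \<in> K" for n t
    using that K(2) by (induction n) (auto simp: \<psi>_def)
  \<comment> \<open>The closure of the orbit from time \<open>M\<close> on is itself closed and
    invariant, so by minimality it is all of \<open>K\<close>. Arbitrary \<open>M\<close> gives
    returns at arbitrarily late times.\<close>
  have dense: "t \<in> closure {(\<phi> ^^ n) t + of_int k | n k. M \<le> n}" if t: "t \<in> K" for t M
  proof -
    define X where "X = {(\<phi> ^^ n) t + of_int k | n k. M \<le> n}"
    have XI: "(\<phi> ^^ n) t + of_int k \<in> X" if "M \<le> n" for n k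
      using that unfolding X_def by blast
    have "X \<subseteq> K"
      using iter_K[OF t] K(2) by (auto simp: X_def \<psi>_def)
    then have "closure X \<subseteq> K"
      using K(1) by (rule closure_minimal)
    moreover have "\<psi> (closure X)"
      unfolding \<psi>_def
    proof (intro conjI ballI allI)
      have "(\<phi> ^^ M) t + of_int (- \<lfloor>(\<phi> ^^ M) t\<rfloor>) \<in> X \<inter> {0..1}"
        using XI[of M "- \<lfloor>(\<phi> ^^ M) t\<rfloor>"] floor_correct[of "(\<phi> ^^ M) t"]
        unfolding Int_iff atLeastAtMost_iff of_int_minus by linarith
      then show "closure X \<inter> {0..1} \<noteq> {}"
        using closure_subset by blast
      have image: "f z \<in> closure X" if f: "f ` X \<subseteq> X" "\<And>z. isCont f z" and z: "z \<in> closure X" for f z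
      proof -
        have "f ` closure X \<subseteq> closure X"
          using f closure_subset[of X]
          by (intro image_closure_subset continuous_at_imp_continuous_on) auto
        with z show ?thesis by blast
      qed
      show "z + of_int k \<in> closure X" if "z \<in> closure X" for z k
      proof (rule image[OF _ _ that])
        show "(\<lambda>z. z + of_int k) ` X \<subseteq> X"
        proof clarify
          fix z assume "z \<in> X"
          then obtain n and l :: int where "M \<le> n" "z = (\<phi> ^^ n) t + of_int l"
            unfolding X_def by blast
          then show "z + of_int k \<in> X"
            using XI[of n "l + k"] by (simp add: add.assoc)
        qed
      qed auto
      show "\<phi> z \<in> closure X" if "z \<in> closure X" for z
      proof (rule image[OF _ cont that])
        show "\<phi> ` X \<subseteq> X"
        proof
          fix w assume "w \<in> \<phi> ` X"
          then obtain n and k :: int where "M \<le> n" "w = \<phi> ((\<phi> ^^ n) t + of_int k)"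
            unfolding X_def by blast
          then have "M \<le> Suc n" "w = (\<phi> ^^ Suc n) t + of_int k"
            using shift[of 1] by auto
          then show "w \<in> X" using XI by blast
        qed
      qed
    qed
    ultimately have "closure X = K"
      using K_min[of "closure X"] by blast
    with t show ?thesis by (simp add: X_def)
  qed
  define B where "B n = {t. (\<phi> ^^ n) t \<in> D}" for n
  \<comment> \<open>The number of hitting times up to \<open>N\<close> that are realized by points
    of \<open>K\<close> in \<open>W\<close>; it is minimized below.\<close>
  define c where "c W = card {n. n \<le> N \<and> B n \<inter> W \<inter> K \<noteq> {}}" for W
  have "open UNIV \<and> UNIV \<inter> K \<noteq> {}"
    using K(2) by (auto simp: \<psi>_def)
  then obtain W where W: "open W" "W \<inter> K \<noteq> {}"
    and W_min: "\<And>V. open V \<Longrightarrow> V \<inter> K \<noteq> {} \<Longrightarrow> c W \<le> c V"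
    using ex_has_least_nat[of "\<lambda>W. open W \<and> W \<inter> K \<noteq> {}" UNIV c] by blast
  from W obtain t0 where t0: "t0 \<in> W" "t0 \<in> K" by blast
  obtain n where n: "n \<le> N" "(\<phi> ^^ n) t0 \<in> D"
    using hit by blast
  obtain U C where UC: "open U" "(\<phi> ^^ n) t0 \<in> U" "closed C" "U \<inter> D = U \<inter> C"
    using locally_closed[OF n(2)] by blast
  have open_vimage: "open ((\<phi> ^^ n) -` V)" if "open V" for V
    using that cont_n by (intro continuous_open_vimage) auto
  define V where "V = W \<inter> (\<phi> ^^ n) -` U"
  have V: "open V" "t0 \<in> V"
    using W t0 UC open_vimage by (auto simp: V_def)
  \<comment> \<open>A point of \<open>K\<close> in \<open>V\<close> outside \<open>B n\<close> has a
    neighbourhood \<open>V'\<close> missing \<open>B n\<close> altogether, because \<open>C\<close>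
    is closed. As \<open>t0\<close> realizes \<open>n\<close> in \<open>W\<close>, the count for
    \<open>V'\<close> would be smaller.\<close>
  have V_D: "(\<phi> ^^ n) t \<in> D" if t: "t \<in> V" "t \<in> K" for t
  proof (rule ccontr)
    assume notin: "(\<phi> ^^ n) t \<notin> D"
    define V' where "V' = V \<inter> (\<phi> ^^ n) -` (- C)"
    have "open V'"
      using V UC open_vimage[of "- C"] by (auto simp: V'_def)
    moreover have "t \<in> V'"
      using t notin UC(4) by (auto simp: V'_def V_def)
    ultimately have "c W \<le> c V'"
      using W_min[of V'] t by blast
    moreover have "c V' < c W"
      unfolding c_def
    proof (intro psubset_card_mono psubsetI)
      show "finite {n. n \<le> N \<and> B n \<inter> W \<inter> K \<noteq> {}}" by simp
      show "{n. n \<le> N \<and> B n \<inter> V' \<inter> K \<noteq> {}} \<subseteq> {n. n \<le> N \<and> B n \<inter> W \<inter> K \<noteq> {}}"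
        by (auto simp: V'_def V_def)
      have "B n \<inter> V' = {}"
        using UC(4) by (auto simp: B_def V'_def V_def)
      moreover have "t0 \<in> B n \<inter> W \<inter> K"
        using n t0 by (auto simp: B_def)
      ultimately show "{n. n \<le> N \<and> B n \<inter> V' \<inter> K \<noteq> {}} \<noteq> {n. n \<le> N \<and> B n \<inter> W \<inter> K \<noteq> {}}"
        using n(1) by blast
    qed
    ultimately show False by simp
  qed
  \<comment> \<open>The recurrent point is \<open>(\<phi> ^^ n) t0\<close>. Density brings the orbit
    of \<open>t0\<close> back into \<open>V\<close>, and \<open>\<phi> ^^ n\<close>, which commutes
    with the dynamics, carries these returns into \<open>D\<close>.\<close>
  show ?thesis
  proof (intro bexI[OF _ n(2)] allI impI)
    fix e :: real and M :: nat assume e: "0 < e"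
    have "eventually (\<lambda>t. dist ((\<phi> ^^ n) t) ((\<phi> ^^ n) t0) < e) (nhds t0)"
      using tendstoD[OF cont_n[unfolded isCont_def] e] e by (simp add: eventually_nhds_conv_at)
    moreover have "eventually (\<lambda>t. t \<in> V) (nhds t0)"
      using V by (rule eventually_nhds_in_open)
    ultimately have "eventually (\<lambda>t. dist ((\<phi> ^^ n) t) ((\<phi> ^^ n) t0) < e \<and> t \<in> V) (nhds t0)"
      by eventually_elim auto
    then obtain d where d: "0 < d"
      "\<And>t. dist t t0 < d \<Longrightarrow> dist ((\<phi> ^^ n) t) ((\<phi> ^^ n) t0) < e \<and> t \<in> V"
      unfolding eventually_nhds_metric by blast
    obtain t where t: "t \<in> {(\<phi> ^^ n) t0 + of_int k | n k. M \<le> n}" "dist t t0 < d"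
      using dense[OF t0(2), of M] d(1) closure_approachable by blast
    then obtain m and k :: int where m: "M \<le> m" "t = (\<phi> ^^ m) t0 + of_int k"
      by blast
    have "t \<in> K"
      using iter_K[OF t0(2), of m] K(2) m by (simp add: \<psi>_def)
    then have "(\<phi> ^^ n) t \<in> D"
      using V_D d(2)[OF t(2)] by blast
    moreover have "(\<phi> ^^ n) t = (\<phi> ^^ m) ((\<phi> ^^ n) t0) + of_int k"
      unfolding m shift by (metis add.commute comp_apply funpow_add)
    ultimately show "\<exists>m\<ge>M. \<exists>k::int. (\<phi> ^^ m) ((\<phi> ^^ n) t0) + of_int k \<in> D \<and>
        \<bar>(\<phi> ^^ m) ((\<phi> ^^ n) t0) + of_int k - (\<phi> ^^ n) t0\<bar> < e"
      using m(1) d(2)[OF t(2)] by (metis dist_real_def)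
  qed
qed

section \<open>Diffeomorphisms close to the identity\<close>

text \<open>The bound \<open>e\<close> is uniform on the non-compact strip and strictly below \<open>1/10\<close>, so that the set is open.\<close>

definition near_id :: "(circle \<times> real \<Rightarrow> circle \<times> real) set"
  where "near_id = {g \<in> Diff 2. \<exists>G e. e < 1 / 10 \<and> Cr_on 2 strip G \<and> is_lift G g \<and>
    (\<forall>vs. set vs \<subseteq> Basis \<and> vs \<noteq> [] \<and> length vs \<le> 2 \<longrightarrow>
      (\<forall>z\<in>strip. norm (partials strip vs G z - partials strip vs (\<lambda>x. x) z) \<le> e))}"

lemma Cr_on_differentiable_on: "Cr_on r S f \<Longrightarrow> 0 < r \<Longrightarrow> f differentiable_on S"
  unfolding Cr_on_def by (drule conjunct1, drule spec[of _ "[]"]) (simp flip: zero_enat_def)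

lemma Cr_on_partials_differentiable_on:
  "Cr_on r S f \<Longrightarrow> 1 < r \<Longrightarrow> v \<in> Basis \<Longrightarrow> partials S [v] f differentiable_on S"
  unfolding Cr_on_def by (drule conjunct1, drule spec[of _ "[v]"]) (simp add: one_enat_def)

lemma Cr_on_continuous_on: "Cr_on r S f \<Longrightarrow> continuous_on S f"
  unfolding Cr_on_def by (drule conjunct2, drule spec[of _ "[]"]) (simp flip: zero_enat_def)

text \<open>Adding a constant leaves the set of derivatives unchanged, so the operators agree even
  where no derivative exists.\<close>

lemma partials_add_const:
  assumes "vs \<noteq> []"
  shows "partials S vs (\<lambda>x. f x + c) = partials S vs f"
proof -
  have "((\<lambda>x. f x + c) has_derivative D) F \<longleftrightarrow> (f has_derivative D) F" for D F
    using has_derivative_add_const[of f D F c] has_derivative_add_const[of "\<lambda>x. f x + c" D F "- c"] by auto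
  then have "frechet_derivative (\<lambda>x. f x + c) F = frechet_derivative f F" for F
    by (simp add: frechet_derivative_def)
  with assms show ?thesis
    by (cases vs) auto
qed

lemma connected_strip: "connected strip"
  unfolding strip_def by (intro convex_connected convex_Times) auto

text \<open>The first components differ by a continuous integer-valued function on the connected
  strip, and the second components agree.\<close>

lemma lifts_differ_by_const:
  assumes "continuous_on strip F" "continuous_on strip G" "is_lift F f" "is_lift G f"
  shows "\<exists>c. \<forall>z\<in>strip. F z = G z + c"
proof -
  have cover: "cover (F z) = cover (G z)" if "z \<in> strip" for z
    using assms(3,4) that by (metis is_lift_def)
  have "(\<lambda>z. fst (F z) - fst (G z)) constant_on strip"
  proof (rule continuous_discrete_range_constant[OF connected_strip])
    show "continuous_on strip (\<lambda>z. fst (F z) - fst (G z))"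
      using assms(1,2) by (intro continuous_intros)
    show "\<exists>e>0. \<forall>y. y \<in> strip \<and> fst (F y) - fst (G y) \<noteq> fst (F x) - fst (G x) \<longrightarrow>
        e \<le> norm (fst (F y) - fst (G y) - (fst (F x) - fst (G x)))" if "x \<in> strip" for x
    proof (intro exI[of _ 1] conjI allI impI)
      fix y assume y: "y \<in> strip \<and> fst (F y) - fst (G y) \<noteq> fst (F x) - fst (G x)"
      then have "fst (F y) - fst (G y) - (fst (F x) - fst (G x)) \<in> \<int>"
        using cover[of y] cover[OF that] by (intro Ints_diff[of "_ - _" "_ - _"]) (auto simp: cover_eq_iff)
      with y show "1 \<le> norm (fst (F y) - fst (G y) - (fst (F x) - fst (G x)))"
        by (simp add: Ints_nonzero_abs_ge1)
    qed simp
  qed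
  then obtain c where c: "\<And>z. z \<in> strip \<Longrightarrow> fst (F z) - fst (G z) = c"
    unfolding constant_on_def by blast
  have "F z = G z + (c, 0)" if "z \<in> strip" for z
    using c[OF that] cover[OF that, unfolded cover_eq_iff] by (auto simp: prod_eq_iff)
  then show ?thesis by blast
qed

text \<open>The lift of \<open>g\<close> in a basic neighbourhood may differ from the lift
  witnessing membership in \<open>near_id\<close>, but only by a constant. Partials of positive
  order do not see this constant.\<close>

lemma openin_near_id: "openin (Cr_topology 2) near_id"
  unfolding openin_Cr_topology Cr_open_def
proof (intro conjI ballI)
  show "near_id \<subseteq> Diff 2"
    by (auto simp: near_id_def)
  fix g assume "g \<in> near_id"
  then obtain G e where e: "e < 1 / 10" and G: "Cr_on 2 strip G" "is_lift G g"
    and G_id: "\<And>vs z. set vs \<subseteq> Basis \<Longrightarrow> vs \<noteq> [] \<Longrightarrow> length vs \<le> 2 \<Longrightarrow> z \<in> strip \<Longrightarrow>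
      norm (partials strip vs G z - partials strip vs (\<lambda>x. x) z) \<le> e"
    unfolding near_id_def by blast
  \<comment> \<open>Half of the slack below \<open>1/10\<close>, so that \<open>e + d\<close> stays
    below it.\<close>
  define d where "d = (1 / 10 - e) / 2"
  have "Cr_nbhd 2 2 d g \<subseteq> near_id"
  proof
    fix h assume "h \<in> Cr_nbhd 2 2 d g"
    then obtain F H where h: "h \<in> Diff 2" and F: "Cr_on 2 strip F" "is_lift F g"
      and H: "Cr_on 2 strip H" "is_lift H h"
      and FH: "\<And>vs z. set vs \<subseteq> Basis \<Longrightarrow> length vs \<le> 2 \<Longrightarrow> z \<in> strip \<Longrightarrow>
        norm (partials strip vs F z - partials strip vs H z) < d"
      unfolding Cr_nbhd_def by blast
    obtain c where c: "\<And>z. z \<in> strip \<Longrightarrow> F z = G z + c"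
      using lifts_differ_by_const[OF Cr_on_continuous_on[OF F(1)] Cr_on_continuous_on[OF G(1)] F(2) G(2)]
      by blast
    have "norm (partials strip vs H z - partials strip vs (\<lambda>x. x) z) \<le> e + d"
      if vs: "set vs \<subseteq> Basis \<and> vs \<noteq> [] \<and> length vs \<le> 2" and z: "z \<in> strip" for vs z
    proof -
      have "partials strip vs F z = partials strip vs (\<lambda>z. G z + c) z"
        using c z by (intro partials_cong)
      also have "\<dots> = partials strip vs G z"
        using vs by (simp add: partials_add_const)
      finally have "norm (partials strip vs G z - partials strip vs H z) < d"
        using FH[of vs z] vs z by simp
      then have "norm (partials strip vs H z - partials strip vs G z) < d"
        by (simp add: norm_minus_commute)
      then show ?thesis
        using G_id[of vs z] vs z norm_triangle_ineq[of "partials strip vs H z - partials strip vs G z"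
            "partials strip vs G z - partials strip vs (\<lambda>x. x) z"] by simp
    qed
    moreover have "e + d < 1 / 10"
      using e by (simp add: d_def field_simps)
    ultimately show "h \<in> near_id"
      unfolding near_id_def using h H by blast
  qed
  moreover have "0 < d"
    using e by (simp add: d_def)
  ultimately show "\<exists>k e. enat k \<le> 2 \<and> 0 < e \<and> Cr_nbhd 2 k e g \<subseteq> near_id"
    by (intro exI[of _ 2] exI[of _ d]) (simp add: numeral_eq_enat)
qed

lemma id_in_near_id: "id_annulus \<in> near_id"
proof -
  have "model_lift 0 = (\<lambda>x. x)"
    by (rule ext) (simp add: model_lift_def prod_map_def sine_map_def)
  then have "Cr_on 2 strip (\<lambda>x. x)" "is_lift (\<lambda>x. x) id_annulus"
    using Cr_on_model_lift[of 2 0] is_lift_model[of 0] by (simp_all add: model_zero)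
  moreover have "id_annulus \<in> Diff 2"
    using model_in_Diff[of 0 2] by (simp add: model_zero)
  ultimately show ?thesis
    unfolding near_id_def by (auto intro!: exI[of _ "\<lambda>x. x"] exI[of _ 0])
qed

section \<open>The induced map of the bottom boundary\<close>

lemma strip_curve_has_vector_derivative:
  assumes "f differentiable_on strip" "c ` S \<subseteq> strip" "t \<in> S"
    and "(c has_vector_derivative c') (at t within S)"
  shows "((\<lambda>t. f (c t)) has_vector_derivative frechet_derivative f (at (c t) within strip) c') (at t within S)"
proof -
  have "(f has_derivative frechet_derivative f (at (c t) within strip)) (at (c t) within strip)"
    using assms(1-3) by (auto simp: differentiable_on_def frechet_derivative_works)
  then have "(f has_derivative frechet_derivative f (at (c t) within strip)) (at (c t) within c ` S)"
    using assms(2) by (rule has_derivative_subset)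
  from vector_derivative_diff_chain_within[OF assms(4) this] show ?thesis
    by (simp add: o_def)
qed

lemma Diff_bij: "g \<in> Diff r \<Longrightarrow> bij_betw g annulus annulus"
  by (simp add: Diff_def)

lemma lift_in_strip:
  assumes "g ` annulus \<subseteq> annulus" "is_lift G g" "z \<in> strip"
  shows "G z \<in> strip"
  using assms cover_in_annulus_iff[of z] cover_in_annulus_iff[of "G z"] by (auto simp: is_lift_def)

text \<open>If an interior point were the image of a boundary point, then by invariance of domain the inverse
  would map a neighbourhood of it onto a neighbourhood in the plane of a point of the boundary.\<close>

lemma Diff_preserves_boundary:
  assumes g: "g \<in> Diff r" and G: "is_lift G g" and z: "z \<in> strip" "snd z = 0"
  shows "snd (G z) \<in> {0, 1}"
proof (rule ccontr)
  assume "snd (G z) \<notin> {0, 1}"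
  let ?k = "inv_into annulus g"
  note bij = Diff_bij[OF g]
  then have k_bij: "bij_betw ?k annulus annulus"
    by (rule bij_betw_inv_into)
  obtain K where K: "Cr_on r strip K" "is_lift K ?k"
    using g by (auto simp: Diff_def Cr_map_def)
  define w where "w = G z"
  have w: "w \<in> strip"
    unfolding w_def by (rule lift_in_strip[OF _ G z(1)]) (simp add: bij_betw_imp_surj_on[OF bij])
  then have "0 < snd w" "snd w < 1"
    using \<open>snd (G z) \<notin> {0, 1}\<close> by (auto simp: w_def strip_def mem_Times_iff)
  \<comment> \<open>The first two bounds keep the ball in the strip; \<open>1/4\<close> makes it so
    narrow that \<open>cover\<close> is injective on it.\<close>
  define r where "r = Min {snd w, 1 - snd w, 1 / 4}"
  have r: "0 < r" "r \<le> snd w" "r \<le> 1 - snd w" "r \<le> 1 / 4"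
    using \<open>0 < snd w\<close> \<open>snd w < 1\<close> by (auto simp: r_def min_def)
  have ball: "ball w r \<subseteq> strip"
  proof
    fix u assume "u \<in> ball w r"
    then have "\<bar>snd w - snd u\<bar> < r"
      using dist_snd_le[of w u] by (simp add: dist_real_def)
    with r show "u \<in> strip" by (auto simp: strip_def mem_Times_iff)
  qed
  have "inj_on K (ball w r)"
  proof (rule inj_onI)
    fix u v assume uv: "u \<in> ball w r" "v \<in> ball w r" "K u = K v"
    then have strip: "u \<in> strip" "v \<in> strip" using ball by auto
    with uv(3) K(2) have "?k (cover u) = ?k (cover v)"
      by (simp add: is_lift_def)
    then have "cover u = cover v"
      using k_bij strip by (auto simp: bij_betw_def inj_on_def cover_in_annulus_iff)
    moreover have "\<bar>fst w - fst u\<bar> < r" "\<bar>fst w - fst v\<bar> < r"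
      using uv(1,2) dist_fst_le[of w u] dist_fst_le[of w v] by (simp_all add: dist_real_def)
    then have "\<bar>fst u - fst v\<bar> < 1"
      using r(4) by linarith
    ultimately have "fst u - fst v = 0" "snd u = snd v"
      using Ints_nonzero_abs_less1[of "fst u - fst v"] by (auto simp: cover_eq_iff)
    then show "u = v" by (simp add: prod_eq_iff)
  qed
  then have "open (K ` ball w r)"
    using Cr_on_continuous_on[OF K(1)] ball by (intro invariance_of_domain) (auto intro: continuous_on_subset)
  moreover have "K w \<in> K ` ball w r"
    using r(1) by simp
  ultimately obtain d where d: "0 < d" "ball (K w) d \<subseteq> K ` ball w r"
    using open_contains_ball by blast
  have "cover (K w) = ?k (g (cover z))"
    using K(2) G w z(1) by (simp add: is_lift_def w_def)
  also have "\<dots> = cover z"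
    using bij z(1) by (simp add: bij_betw_def cover_in_annulus_iff)
  finally have "snd (K w) = 0"
    using z(2) by (simp add: cover_eq_iff)
  \<comment> \<open>This point lies below the strip, yet openness of the image puts it among the
    values of \<open>K\<close>.\<close>
  have "(fst (K w), snd (K w) - d / 2) \<in> ball (K w) d"
    using d(1) by (simp add: dist_prod_def dist_real_def)
  then obtain u where u: "u \<in> ball w r" "K u = (fst (K w), snd (K w) - d / 2)"
    using d(2) by force
  then have "K u \<in> strip"
    using ball by (intro lift_in_strip[OF _ K(2)]) (auto simp: bij_betw_imp_surj_on[OF k_bij])
  with u \<open>snd (K w) = 0\<close> d(1) show False
    by (simp add: strip_def)
qed

text \<open>This supplies the hypotheses of \<open>periodic_multiplier_bound\<close> with Lipschitz
  constant \<open>1/4\<close>, the threshold that the multipliers of the model exceed in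
  \<open>abs_ln_power_gt\<close>.\<close>

lemma near_id_boundary_map:
  assumes "g \<in> near_id"
  obtains \<phi> \<phi>' :: "real \<Rightarrow> real" where
    "\<And>t. g (cover (t, 0)) = cover (\<phi> t, 0)"
    "\<And>t. \<phi> (t + 1) = \<phi> t + 1"
    "\<And>t. (\<phi> has_real_derivative \<phi>' t) (at t)"
    "\<And>t. 0 < \<phi>' t"
    "\<And>s t. \<bar>ln (\<phi>' s) - ln (\<phi>' t)\<bar> \<le> 1 / 4 * \<bar>s - t\<bar>"
proof -
  obtain G e where g: "g \<in> Diff 2" and e: "e < 1 / 10" and G: "Cr_on 2 strip G" "is_lift G g"
    and G_id: "\<And>vs z. set vs \<subseteq> Basis \<Longrightarrow> vs \<noteq> [] \<Longrightarrow> length vs \<le> 2 \<Longrightarrow> z \<in> strip \<Longrightarrow>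
      norm (partials strip vs G z - partials strip vs (\<lambda>x. x) z) \<le> e"
    using assms unfolding near_id_def by blast
  have diff: "G differentiable_on strip"
    using G(1) by (rule Cr_on_differentiable_on) simp
  have diff2: "partials strip [(1, 0)] G differentiable_on strip"
    using G(1) by (rule Cr_on_partials_differentiable_on) (auto simp: Basis_real2 one_less_numeral_iff)
  have id1: "frechet_derivative (\<lambda>x. x) (at z within strip) = (\<lambda>x. x)" if "z \<in> strip" for z
    using that by (intro frechet_derivative_strip) (auto intro: derivative_intros)
  have G1: "norm (frechet_derivative G (at z within strip) v - v) \<le> e" if "v \<in> Basis" "z \<in> strip" for v z
    using G_id[of "[v]" z] that by (simp add: id1)
  have G2: "norm (partials strip [(1, 0), (1, 0)] G z) \<le> e" if z: "z \<in> strip" for z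
  proof -
    have "partials strip [(1, 0), (1, 0)] (\<lambda>x::real \<times> real. x) z =
        partials strip [(1, 0)] (\<lambda>x. (1 :: real, 0 :: real)) z"
      using z id1 by (simp only: partials.simps(2)[of _ "(1, 0)" "[(1, 0)]"]) (rule partials_cong; simp)
    also have "\<dots> = 0"
      using z frechet_derivative_strip[OF z, of "\<lambda>x. (1 :: real, 0 :: real)" "\<lambda>x. 0"] by simp
    finally show ?thesis
      using G_id[of "[(1, 0), (1, 0)]" z] z by (simp add: Basis_real2)
  qed
  define \<phi> \<phi>' \<phi>'' where "\<phi> t = fst (G (t, 0))" and "\<phi>' t = fst (partials strip [(1, 0)] G (t, 0))"
    and "\<phi>'' t = fst (partials strip [(1, 0), (1, 0)] G (t, 0))" for t
  have line: "((\<lambda>t. (t, 0)) has_vector_derivative (1, 0)) (at t)" for t :: real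
    by (intro has_vector_derivative_Pair) auto
  have strip0: "(t, 0) \<in> strip" for t
    by (simp add: strip_def)
  have \<phi>: "(\<phi> has_real_derivative \<phi>' t) (at t)" for t
    using bounded_linear.has_vector_derivative[OF bounded_linear_fst
        strip_curve_has_vector_derivative[OF diff _ _ line[of t]]] strip0
    by (simp add: \<phi>_def[abs_def] \<phi>'_def has_real_derivative_iff_has_vector_derivative image_subset_iff)
  have \<phi>': "(\<phi>' has_real_derivative \<phi>'' t) (at t)" for t
    using bounded_linear.has_vector_derivative[OF bounded_linear_fst
        strip_curve_has_vector_derivative[OF diff2 _ _ line[of t]]] strip0
    by (simp add: \<phi>'_def[abs_def] \<phi>''_def has_real_derivative_iff_has_vector_derivative image_subset_iff)
  have fst_le: "\<bar>fst v\<bar> \<le> norm v" "\<bar>snd v\<bar> \<le> norm v" for v :: "real \<times> real"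
    using norm_fst_le[of "fst v" "snd v"] norm_snd_le[of "snd v" "fst v"] by auto
  have bound1: "\<bar>\<phi>' t - 1\<bar> \<le> 1 / 10" for t
    using G1[of "(1, 0)" "(t, 0)"] fst_le(1)[of "frechet_derivative G (at (t, 0) within strip) (1, 0) - (1, 0)"]
      e strip0 by (simp add: \<phi>'_def Basis_real2)
  have bound2: "\<bar>\<phi>'' t\<bar> \<le> 1 / 10" for t
    using G2[OF strip0, of t] fst_le(1)[of "partials strip [(1, 0), (1, 0)] G (t, 0)"] e
    by (simp add: \<phi>''_def)
  have pos: "9 / 10 \<le> \<phi>' t" for t
    using bound1[of t] by linarith
  have pos0: "0 < \<phi>' t" for t
    using pos[of t] by linarith
  \<comment> \<open>The derivative of \<open>ln \<phi>'\<close> is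
    \<open>\<phi>'' / \<phi>'\<close>, at most \<open>(1/10) / (9/10) = 1/9\<close> in absolute
    value.\<close>
  have lip: "\<bar>ln (\<phi>' s) - ln (\<phi>' t)\<bar> \<le> 1 / 4 * \<bar>s - t\<bar>" for s t
  proof -
    have "norm (ln (\<phi>' s) - ln (\<phi>' t)) \<le> 1 / 4 * norm (s - t)"
    proof (rule field_differentiable_bound[where S = UNIV])
      show "((\<lambda>t. ln (\<phi>' t)) has_field_derivative \<phi>'' t / \<phi>' t) (at t within UNIV)" for t
        using pos0 \<phi>' by (auto intro!: derivative_eq_intros simp: less_imp_neq[symmetric])
      show "norm (\<phi>'' t / \<phi>' t) \<le> 1 / 4" for t
        using pos[of t] bound2[of t] by (simp add: field_simps)
    qed auto
    then show ?thesis by simp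
  qed
  \<comment> \<open>The degree is an integer and also a value of \<open>\<phi>'\<close>, hence
    within \<open>1/10\<close> of 1.\<close>
  have deg: "\<phi> (t + 1) = \<phi> t + 1" for t
  proof -
    have "cover (G (t + 1, 0)) = cover (G (t, 0))"
      using G(2) strip0 cover_add_int[of t 1 0] by (metis is_lift_def of_int_1)
    then have "\<phi> (t + 1) - \<phi> t \<in> \<int>"
      by (simp add: cover_eq_iff \<phi>_def)
    then obtain k :: int where k: "\<phi> (t + 1) - \<phi> t = of_int k"
      by (elim Ints_cases)
    obtain \<xi> where "\<phi> (t + 1) - \<phi> t = (t + 1 - t) * \<phi>' \<xi>"
      using MVT2[of t "t + 1" \<phi> \<phi>'] \<phi> by auto
    then have "\<bar>of_int k - 1 :: real\<bar> \<le> 1 / 10"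
      using bound1[of \<xi>] k by simp
    then have "k = 1" by linarith
    with k show ?thesis by simp
  qed
  \<comment> \<open>The height gained along a vertical segment is at least \<open>9/10\<close>, so
    the bottom end cannot be sent to the top; by \<open>Diff_preserves_boundary\<close> it stays at
    the bottom.\<close>
  have bottom: "snd (G (t, 0)) = 0" for t
  proof -
    have vert: "((\<lambda>s. (t, s)) has_vector_derivative (0, 1)) (at s within {0..1})" for s :: real
      by (intro has_vector_derivative_Pair) auto
    have vert_strip: "(\<lambda>s. (t, s)) ` {0..1} \<subseteq> strip"
      by (auto simp: strip_def)
    have "((\<lambda>s. snd (G (t, s))) has_derivative (\<lambda>h. h * snd (frechet_derivative G (at (t, s) within strip) (0, 1))))
        (at s within {0..1})" if "s \<in> {0..1}" for s
      using bounded_linear.has_vector_derivative[OF bounded_linear_snd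
          strip_curve_has_vector_derivative[OF diff vert_strip that vert]]
      by (simp add: has_vector_derivative_def)
    then obtain \<xi> where \<xi>: "\<xi> \<in> {0<..<1}"
      "snd (G (t, 1)) - snd (G (t, 0)) = (1 - 0) * snd (frechet_derivative G (at (t, \<xi>) within strip) (0, 1))"
      using mvt_simple[of 0 1 "\<lambda>s. snd (G (t, s))"
          "\<lambda>s h. h * snd (frechet_derivative G (at (t, s) within strip) (0, 1))"] by force
    have "\<bar>snd (frechet_derivative G (at (t, \<xi>) within strip) (0, 1)) - 1\<bar> \<le> 1 / 10"
      using G1[of "(0, 1)" "(t, \<xi>)"] e \<xi>(1)
        fst_le(2)[of "frechet_derivative G (at (t, \<xi>) within strip) (0, 1) - (0, 1)"]
      by (simp add: Basis_real2 strip_def)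
    then have "9 / 10 \<le> snd (G (t, 1)) - snd (G (t, 0))"
      unfolding \<xi>(2) diff_zero mult_1 by linarith
    moreover have "G (t, 1) \<in> strip"
      by (rule lift_in_strip[OF _ G(2)]) (simp_all add: bij_betw_imp_surj_on[OF Diff_bij[OF g]] strip_def)
    ultimately have "snd (G (t, 0)) < 1"
      by (simp add: strip_def mem_Times_iff)
    then show ?thesis
      using Diff_preserves_boundary[OF g G(2) strip0, of t] by simp
  qed
  have "g (cover (t, 0)) = cover (\<phi> t, 0)" for t
  proof -
    have "G (t, 0) = (\<phi> t, 0)"
      using bottom[of t] by (simp add: \<phi>_def prod_eq_iff)
    then show ?thesis
      using G(2) strip0[of t] by (simp add: is_lift_def)
  qed
  then show thesis
    using that[of \<phi> \<phi>'] deg \<phi> pos0 lip by blast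
qed

section \<open>Corners, first returns and multipliers\<close>

text \<open>Injectivity of the chart turns the equality of images into a pointwise test.\<close>

lemma Cr_diffeo_on_mem_iff:
  assumes "Cr_diffeo_on r U \<phi>" "\<phi> ` (U \<inter> A) = \<phi> ` U \<inter> B" "w \<in> U"
  shows "w \<in> A \<longleftrightarrow> \<phi> w \<in> B"
proof -
  have "inj_on \<phi> U"
    using assms(1) by (simp add: Cr_diffeo_on_def)
  then have "\<phi> w \<in> \<phi> ` (U \<inter> A) \<longleftrightarrow> w \<in> U \<inter> A"
    using assms(3) by (intro inj_on_image_mem_iff) auto
  with assms(2,3) show ?thesis by auto
qed

text \<open>The bottom of the strip is mapped by the chart into a coordinate line; on it, the only condition
  defining \<open>\<Delta>\<close> that is not automatic is that a strictly monotone function be nonnegative.\<close>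

lemma corner_boundary_arc:
  assumes \<Delta>: "submanifold_with_corners r \<Delta>" "cover (s, 0) \<in> \<Delta>"
  shows "\<exists>S\<in>{{s<..}, {..<s}}. \<forall>\<^sub>F t in at s within S. cover (t, 0) \<in> \<Delta>"
proof -
  obtain U \<phi> I J where U: "(s, 0) \<in> U" and \<phi>: "Cr_diffeo_on r U \<phi>" and IJ: "I \<subseteq> J" "J \<subseteq> Basis"
    and I: "\<phi> ` (U \<inter> strip) = \<phi> ` U \<inter> orthant I"
    and J: "\<phi> ` (U \<inter> cover -` \<Delta>) = \<phi> ` U \<inter> orthant J"
    using \<Delta> unfolding submanifold_with_corners_def by blast
  have opn: "open U" and inj: "inj_on \<phi> U" and cont: "continuous_on U \<phi>"
    using \<phi> Cr_on_continuous_on by (auto simp: Cr_diffeo_on_def)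
  obtain d0 where "0 < d0" and ball: "ball (s, 0) d0 \<subseteq> U"
    using opn U open_contains_ball by blast
  define d where "d = d0 / 2"
  have d: "0 < d"
    using \<open>0 < d0\<close> by (simp add: d_def)
  have in_U: "(t, 0) \<in> U" if "t \<in> {s - d..s + d}" for t
    using that ball \<open>0 < d0\<close> by (intro subsetD[OF ball]) (auto simp: dist_prod_def dist_real_def d_def)
  have in_\<Delta>: "cover w \<in> \<Delta> \<longleftrightarrow> \<phi> w \<in> orthant J" if "w \<in> U" for w
    using Cr_diffeo_on_mem_iff[OF \<phi> J that] by simp
  have nonneg: "0 \<le> \<phi> (t, 0) \<bullet> i" if "t \<in> {s - d..s + d}" "i \<in> I" for t i
    using Cr_diffeo_on_mem_iff[OF \<phi> I in_U[OF that(1)]] that(2) by (auto simp: orthant_def strip_def)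
  \<comment> \<open>If all coordinates in \<open>I\<close> were positive at a bottom point, they
    would stay positive nearby, and the chart would place points below the strip inside it.\<close>
  have zero: "\<exists>i\<in>I. \<phi> (t, 0) \<bullet> i = 0" if t: "t \<in> {s - d..s + d}" for t
  proof (rule ccontr)
    assume "\<not> ?thesis"
    then have pos: "0 < \<phi> (t, 0) \<bullet> i" if "i \<in> I" for i
      using nonneg[OF t that] that by force
    define V where "V = U \<inter> \<phi> -` (\<Inter>i\<in>I. {x. 0 < x \<bullet> i})"
    have "finite I"
      by (rule finite_subset[OF subset_trans[OF IJ] finite_Basis])
    then have "open (\<Inter>i\<in>I. {x. 0 < x \<bullet> i})"
      by (intro open_INT ballI open_Collect_less continuous_intros)
    with cont opn have "open V"
      unfolding V_def by (rule continuous_open_preimage)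
    moreover have "(t, 0) \<in> V"
      using pos in_U[OF t] by (auto simp: V_def)
    ultimately obtain e where e: "0 < e" "ball (t, 0) e \<subseteq> V"
      using open_contains_ball by blast
    have "(t, - (e / 2)) \<in> ball (t, 0) e"
      using e(1) by (simp add: dist_prod_def dist_real_def)
    then have w: "(t, - (e / 2)) \<in> V" using e(2) by blast
    then have "\<phi> (t, - (e / 2)) \<in> orthant I"
      by (auto simp: V_def orthant_def less_imp_le)
    moreover have "(t, - (e / 2)) \<in> U"
      using w by (simp add: V_def)
    ultimately have "(t, - (e / 2)) \<in> strip"
      using Cr_diffeo_on_mem_iff[OF \<phi> I] by blast
    with e(1) show False by (simp add: strip_def)
  qed
  have nhd: "\<forall>\<^sub>F t in at s within S. t \<in> {s - d<..<s + d}" for S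
    using d eventually_at_in_open'[of "{s - d<..<s + d}" s]
    by (auto intro: filter_leD[OF at_le[of S UNIV s]])
  show ?thesis
  proof (cases "I = J")
    case True
    have "cover (t, 0) \<in> \<Delta>" if "t \<in> {s - d<..<s + d}" for t
    proof -
      have t: "t \<in> {s - d..s + d}" using that by auto
      show ?thesis
        using in_\<Delta>[OF in_U[OF t]] nonneg[OF t] True by (auto simp: orthant_def)
    qed
    then show ?thesis
      using nhd[of "{s<..}"] by (auto elim: eventually_mono)
  next
    \<comment> \<open>In the plane this forces \<open>I = {i}\<close> and \<open>J = {i, j}\<close>.
      Along the bottom the coordinate \<open>i\<close> vanishes, so \<open>j\<close> alone
      determines the chart there and is injective, hence strictly monotone.\<close>
    case False
    have s: "s \<in> {s - d..s + d}" using d by auto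
    obtain i j where i: "i \<in> I" and j: "j \<in> J" "j \<notin> I"
      using zero[OF s] False IJ by blast
    then have "i \<in> Basis" "j \<in> Basis" "i \<noteq> j"
      using IJ by auto
    then have B: "Basis = {i, j}"
      unfolding Basis_real2 by auto
    then have basis: "Basis = {i, j}" "I = {i}" "J = {i, j}"
      using IJ i j by auto
    have i0: "\<phi> (t, 0) \<bullet> i = 0" if "t \<in> {s - d..s + d}" for t
      using zero[OF that] basis(2) by auto
    define \<beta> where "\<beta> t = \<phi> (t, 0) \<bullet> j" for t
    have \<Delta>I: "cover (t, 0) \<in> \<Delta>" if "t \<in> {s - d..s + d}" "0 \<le> \<beta> t" for t
      using in_\<Delta>[OF in_U[OF that(1)]] i0[OF that(1)] that(2) by (auto simp: basis orthant_def \<beta>_def)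
    have \<beta>_s: "0 \<le> \<beta> s"
      using in_\<Delta>[OF U] \<Delta>(2) j(1) by (auto simp: orthant_def \<beta>_def)
    have \<beta>_cont: "continuous_on {a..b} \<beta>" if "s - d \<le> a" "b \<le> s + d" for a b
      unfolding \<beta>_def using that in_U
      by (intro continuous_intros continuous_on_compose2[OF cont]) auto
    have \<beta>_inj: "inj_on \<beta> {s - d..s + d}"
    proof (rule inj_onI)
      fix t u assume tu: "t \<in> {s - d..s + d}" "u \<in> {s - d..s + d}" "\<beta> t = \<beta> u"
      have "\<phi> (t, 0) \<bullet> b = \<phi> (u, 0) \<bullet> b" if "b \<in> Basis" for b
      proof (cases "b = i")
        case True
        then show ?thesis
          by (simp add: i0[OF tu(1)] i0[OF tu(2)])
      next
        case False
        then have "b = j"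
          using that B by blast
        then show ?thesis
          using tu(3) by (simp add: \<beta>_def)
      qed
      then have "\<phi> (t, 0) = \<phi> (u, 0)"
        by (rule euclidean_eqI)
      then show "t = u"
        using inj_onD[OF inj _ in_U[OF tu(1)] in_U[OF tu(2)]] by simp
    qed
    have mono: "(\<beta> a < \<beta> x \<and> \<beta> x < \<beta> b) \<or> (\<beta> b < \<beta> x \<and> \<beta> x < \<beta> a)"
      if "s - d \<le> a" "a < x" "x < b" "b \<le> s + d" for a x b
      using that by (intro continuous_inj_imp_mono \<beta>_cont inj_on_subset[OF \<beta>_inj]) auto
    \<comment> \<open>As \<open>\<beta> s\<close> is nonnegative, the arc lies on the side on which
      \<open>\<beta>\<close> increases away from \<open>s\<close>.\<close>
    from mono[of "s - d" s "s + d"] d consider "\<beta> s < \<beta> (s + d)" | "\<beta> s < \<beta> (s - d)"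
      by force
    then show ?thesis
    proof cases
      case 1
      have "cover (t, 0) \<in> \<Delta>" if "t \<in> {s - d<..<s + d}" "t \<in> {s<..}" for t
        using mono[of s t "s + d"] d that 1 \<beta>_s by (intro \<Delta>I) auto
      then have "\<forall>\<^sub>F t in at s within {s<..}. cover (t, 0) \<in> \<Delta>"
        using nhd[of "{s<..}"] eventually_at_filter by (auto simp: eventually_at_filter elim: eventually_mono)
      then show ?thesis by blast
    next
      case 2
      have "cover (t, 0) \<in> \<Delta>" if "t \<in> {s - d<..<s + d}" "t \<in> {..<s}" for t
        using mono[of "s - d" t s] d that 2 \<beta>_s by (intro \<Delta>I) auto
      then have "\<forall>\<^sub>F t in at s within {..<s}. cover (t, 0) \<in> \<Delta>"
        using nhd[of "{..<s}"] by (auto simp: eventually_at_filter elim: eventually_mono)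
      then show ?thesis by blast
    qed
  qed
qed

text \<open>In a chart \<open>\<Delta>\<close> is the preimage of a closed orthant.\<close>

lemma corner_locally_closed:
  assumes "submanifold_with_corners r \<Delta>" "cover (t, 0) \<in> \<Delta>"
  shows "\<exists>V C. open V \<and> t \<in> V \<and> closed C \<and> V \<inter> {t. cover (t, 0) \<in> \<Delta>} = V \<inter> C"
proof -
  obtain U \<phi> J where U: "(t, 0) \<in> U" and \<phi>: "Cr_diffeo_on r U \<phi>"
    and J: "\<phi> ` (U \<inter> cover -` \<Delta>) = \<phi> ` U \<inter> orthant J"
    using assms unfolding submanifold_with_corners_def by blast
  have opn: "open U" and cont: "continuous_on U \<phi>"
    using \<phi> Cr_on_continuous_on by (auto simp: Cr_diffeo_on_def)
  have in_\<Delta>: "cover w \<in> \<Delta> \<longleftrightarrow> \<phi> w \<in> orthant J" if "w \<in> U" for w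
    using Cr_diffeo_on_mem_iff[OF \<phi> J that] by simp
  have "orthant J = (\<Inter>i\<in>J. {w. 0 \<le> w \<bullet> i})"
    by (auto simp: orthant_def)
  then have "closed (orthant J)"
    by (auto intro!: closed_INT closed_Collect_le continuous_intros)
  then obtain C where C: "closed C" "C \<inter> U = \<phi> -` orthant J \<inter> U"
    using cont unfolding continuous_on_closed_invariant by blast
  have line: "continuous_on UNIV (\<lambda>t :: real. (t, 0 :: real))"
    by (intro continuous_intros)
  show ?thesis
  proof (intro exI conjI)
    show "open ((\<lambda>t. (t, 0)) -` U)" "closed ((\<lambda>t. (t, 0)) -` C)"
      using opn C(1) line by (auto intro: open_vimage closed_vimage)
    show "t \<in> (\<lambda>t. (t, 0)) -` U"
      using U by simp
    show "(\<lambda>t. (t, 0)) -` U \<inter> {t. cover (t, 0) \<in> \<Delta>} = (\<lambda>t. (t, 0)) -` U \<inter> (\<lambda>t. (t, 0)) -` C"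
      using C(2) in_\<Delta> by auto
  qed
qed

section \<open>First returns and hitting times\<close>

lemma return_time_props:
  assumes "\<exists>n\<ge>1. (g ^^ n) x \<in> \<Delta>"
  shows "1 \<le> return_time g \<Delta> x" "first_return g \<Delta> x \<in> \<Delta>"
  using LeastI_ex[of "\<lambda>n. 1 \<le> n \<and> (g ^^ n) x \<in> \<Delta>"] assms
  by (auto simp: return_time_def first_return_def)

lemma return_time_le: "1 \<le> n \<Longrightarrow> (g ^^ n) x \<in> \<Delta> \<Longrightarrow> return_time g \<Delta> x \<le> n"
  unfolding return_time_def by (rule Least_le) simp

text \<open>A return at time \<open>n\<close> splits into consecutive first returns, each taking
  between 1 and \<open>N\<close> steps. The bound \<open>n \<le> N * r\<close> makes the number of
  first returns tend to infinity with \<open>n\<close>.\<close>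

lemma funpow_return:
  assumes ret: "\<And>x. x \<in> \<Delta> \<Longrightarrow> \<exists>n\<ge>1. (g ^^ n) x \<in> \<Delta>"
    and bound: "\<And>x. x \<in> \<Delta> \<Longrightarrow> return_time g \<Delta> x \<le> N"
    and "x \<in> \<Delta>" "1 \<le> n" "(g ^^ n) x \<in> \<Delta>"
  shows "\<exists>r\<ge>1. r \<le> n \<and> n \<le> N * r \<and> (first_return g \<Delta> ^^ r) x = (g ^^ n) x"
  using assms(3-)
proof (induction n arbitrary: x rule: less_induct)
  case (less n)
  let ?\<tau> = "return_time g \<Delta> x"
  have \<tau>: "1 \<le> ?\<tau>" "?\<tau> \<le> n" "?\<tau> \<le> N" and R: "first_return g \<Delta> x \<in> \<Delta>"
    using return_time_props[OF ret] return_time_le bound less.prems by auto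
  show ?case
  proof (cases "?\<tau> = n")
    case True
    then show ?thesis
      using \<tau> by (intro exI[of _ 1]) (auto simp: first_return_def)
  next
    case False
    have gn: "(g ^^ (n - ?\<tau>)) (first_return g \<Delta> x) = (g ^^ n) x"
      using funpow_add[of "n - ?\<tau>" ?\<tau> g] \<tau> by (simp add: first_return_def)
    have "1 \<le> n - ?\<tau>" "n - ?\<tau> < n"
      using False \<tau> by auto
    with less.IH[of "n - ?\<tau>" "first_return g \<Delta> x"] R less.prems(3) gn
    obtain r where r: "1 \<le> r" "r \<le> n - ?\<tau>" "n - ?\<tau> \<le> N * r"
      "(first_return g \<Delta> ^^ r) (first_return g \<Delta> x) = (g ^^ n) x"
      by auto
    have "n \<le> N * Suc r"
      using r(3) \<tau> by simp
    moreover have "(first_return g \<Delta> ^^ Suc r) x = (g ^^ n) x"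
      using r(4) by (simp only: funpow_Suc_right o_apply)
    ultimately show ?thesis
      using r \<tau> by (intro exI[of _ "Suc r"]) auto
  qed
qed

text \<open>Choose \<open>y\<close> in \<open>\<Delta>\<close> reaching \<open>p\<close> in the
  least possible time \<open>n\<close>. Then \<open>y\<close> has not returned by time
  \<open>n\<close>, and its first return, at most \<open>N\<close> steps after the start, is also a
  hit for \<open>p\<close>.\<close>

lemma bounded_hitting_time:
  assumes ret: "\<And>x. x \<in> \<Delta> \<Longrightarrow> \<exists>n\<ge>1. (g ^^ n) x \<in> \<Delta>"
    and bound: "\<And>x. x \<in> \<Delta> \<Longrightarrow> return_time g \<Delta> x \<le> N"
    and p: "p \<in> (\<Union>n. (g ^^ n) ` \<Delta>)"
  shows "\<exists>n\<le>N. (g ^^ n) p \<in> \<Delta>"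
proof -
  define n where "n = (LEAST n. p \<in> (g ^^ n) ` \<Delta>)"
  obtain n0 where "p \<in> (g ^^ n0) ` \<Delta>"
    using p by blast
  then have "p \<in> (g ^^ n) ` \<Delta>"
    unfolding n_def by (rule LeastI)
  then obtain y where y: "y \<in> \<Delta>" "p = (g ^^ n) y" by blast
  let ?\<tau> = "return_time g \<Delta> y"
  have "n < ?\<tau>"
  proof (rule ccontr)
    assume "\<not> n < ?\<tau>"
    then have "p = (g ^^ (n - ?\<tau>)) (first_return g \<Delta> y)"
      using y(2) funpow_add[of "n - ?\<tau>" ?\<tau> g] by (simp add: first_return_def)
    then have "p \<in> (g ^^ (n - ?\<tau>)) ` \<Delta>"
      using return_time_props(2)[OF ret[OF y(1)]] by blast
    then have "n \<le> n - ?\<tau>"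
      unfolding n_def by (rule Least_le)
    then show False
      using return_time_props(1)[OF ret[OF y(1)]] \<open>\<not> n < ?\<tau>\<close> by simp
  qed
  then have "(g ^^ (?\<tau> - n)) p = first_return g \<Delta> y"
    using y(2) funpow_add[of "?\<tau> - n" n g] by (simp add: first_return_def)
  then show ?thesis
    using return_time_props(2)[OF ret[OF y(1)]] bound[OF y(1)]
    by (intro exI[of _ "?\<tau> - n"]) auto
qed

lemma funpow_conjugate:
  assumes "\<And>x. x \<in> \<Delta> \<Longrightarrow> R x \<in> \<Delta>" "\<And>x. x \<in> \<Delta> \<Longrightarrow> G (H x) = H (R x)" "x \<in> \<Delta>"
  shows "(G ^^ n) (H x) = H ((R ^^ n) x)"
proof -
  have "(R ^^ n) x \<in> \<Delta> \<and> (G ^^ n) (H x) = H ((R ^^ n) x)"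
    by (induction n) (auto simp: assms)
  then show ?thesis ..
qed

text \<open>Distinct derivatives would make the difference of the difference quotients eventually
  nonzero.\<close>

lemma frequently_eq_imp_deriv_eq:
  assumes f: "(f has_real_derivative f') (at x within S)" and g: "(g has_real_derivative g') (at x within S)"
    and "f x = g x" and freq: "\<exists>\<^sub>F t in at x within S. f t = g t"
  shows "f' = g'"
proof (rule ccontr)
  assume "f' \<noteq> g'"
  have "((\<lambda>t. (f t - f x) / (t - x) - (g t - g x) / (t - x)) \<longlongrightarrow> f' - g') (at x within S)"
    using f g by (intro tendsto_diff) (auto simp: has_field_derivative_iff)
  then have "\<forall>\<^sub>F t in at x within S. (f t - f x) / (t - x) - (g t - g x) / (t - x) \<noteq> 0"
    using \<open>f' \<noteq> g'\<close> by (intro tendsto_imp_eventually_ne) auto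
  then have "\<forall>\<^sub>F t in at x within S. f t \<noteq> g t"
    by eventually_elim (auto simp: \<open>f x = g x\<close>)
  with freq show False
    by (simp add: frequently_def)
qed

text \<open>From \<open>ln x \<le> x - 1\<close> at \<open>1/2\<close> and \<open>2/3\<close> the
  absolute logarithms are at least \<open>1/2\<close> and \<open>1/3\<close>, and powers only
  enlarge them.\<close>

lemma abs_ln_power_gt:
  assumes "x = 1 / 2 \<or> x = (3 / 2 :: real)" "1 \<le> j"
  shows "1 / 4 < \<bar>ln (x ^ j)\<bar>"
proof -
  have "ln (1 / 2 :: real) \<le> 1 / 2 - 1" "ln (2 / 3 :: real) \<le> 2 / 3 - 1"
    by (rule ln_le_minus_one, simp)+
  moreover have "ln (3 / 2 :: real) = - ln (2 / 3)"
    by (simp add: ln_div)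
  ultimately have "1 / 4 < \<bar>ln (1 / 2 :: real)\<bar>" "1 / 4 < \<bar>ln (3 / 2 :: real)\<bar>"
    by linarith+
  then have "1 / 4 < \<bar>ln x\<bar>"
    using assms(1) by (elim disjE) (simp_all only:)
  also have "\<dots> \<le> real j * \<bar>ln x\<bar>"
    using assms(2) mult_right_mono[of 1 "real j" "\<bar>ln x\<bar>"] by simp
  also have "\<dots> = \<bar>ln (x ^ j)\<bar>"
    using assms(1) by (auto simp: ln_realpow abs_mult)
  finally show ?thesis .
qed

text \<open>The exponent may vary with \<open>t\<close>, but one of its finitely many values occurs
  frequently. Differentiating the relation for this \<open>j\<close> and cancelling \<open>v\<close>
  gives \<open>\<mu> = c ^ j\<close>, and \<open>c\<close> is \<open>1/2\<close> or
  \<open>3/2\<close> because the cosine is 1 or -1 at a fixed point.\<close>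

lemma sine_map_semiconjugate_multiplier:
  assumes b: "b > 0" and fixed: "sine_map b (1/2) (a s) = a s"
    and a: "(a has_real_derivative v) (at s)" "v \<noteq> 0"
    and \<psi>: "(\<psi> has_real_derivative \<mu>) (at s)" "\<psi> s = s"
    and freq: "\<exists>\<^sub>F t in at s within S. \<exists>j\<in>{1..m}. a (\<psi> t) = (sine_map b (1/2) ^^ j) (a t)"
  shows "1 / 4 < \<bar>ln \<mu>\<bar>"
proof -
  let ?f = "sine_map b (1/2)"
  define c where "c = 1 + 1/2 * cos (b * a s)"
  obtain j where j: "1 \<le> j" "\<exists>\<^sub>F t in at s within S. a (\<psi> t) = (?f ^^ j) (a t)"
    using frequently_bex_finite[OF _ freq] by auto
  have iter: "(?f ^^ j) (a s) = a s"
    using fixed by (induction j) auto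
  have "(a has_real_derivative v) (at (\<psi> s))"
    using a(1) \<psi>(2) by simp
  then have "((\<lambda>t. a (\<psi> t)) has_real_derivative v * \<mu>) (at s)"
    using \<psi>(1) by (rule DERIV_chain2)
  moreover have "((\<lambda>t. (?f ^^ j) (a t)) has_real_derivative c ^ j * v) (at s)"
    unfolding c_def using b fixed
    by (intro DERIV_chain2[OF _ a(1)] sine_map_funpow_has_real_derivative) auto
  moreover have "a (\<psi> s) = (?f ^^ j) (a s)"
    using iter \<psi>(2) by simp
  ultimately have "v * \<mu> = c ^ j * v"
    using frequently_eq_imp_deriv_eq[OF has_field_derivative_at_within has_field_derivative_at_within _ j(2)]
    by blast
  then have "\<mu> = c ^ j"
    using a(2) by simp
  moreover have "\<bar>cos (b * a s)\<bar> = 1"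
    using fixed b sine_map_fixed_iff[of b "1/2" "a s"] by (intro sin_zero_abs_cos_one) simp
  then have "c = 1 / 2 \<or> c = 3 / 2"
    unfolding c_def by (auto simp: abs_if split: if_splits)
  ultimately show ?thesis
    using abs_ln_power_gt[OF _ j(1)] by simp
qed

text \<open>By the chain rule the derivative of the inverse is a left inverse of
  \<open>D\<close>.\<close>

lemma Cr_diffeo_on_has_derivative:
  assumes \<Phi>: "Cr_diffeo_on r U \<Phi>" "0 < r" "z \<in> U"
  obtains D where "(\<Phi> has_derivative D) (at z)" "\<And>w. D w = 0 \<Longrightarrow> w = 0"
proof -
  have U: "open U" "open (\<Phi> ` U)" "inj_on \<Phi> U"
    and diff: "\<Phi> differentiable_on U" "inv_into U \<Phi> differentiable_on \<Phi> ` U"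
    using \<Phi> Cr_on_differentiable_on by (auto simp: Cr_diffeo_on_def)
  obtain D where D: "(\<Phi> has_derivative D) (at z)"
    using diff(1) \<Phi>(3) at_within_open[OF \<Phi>(3) U(1)]
    unfolding differentiable_on_def differentiable_def by metis
  obtain E where E: "(inv_into U \<Phi> has_derivative E) (at (\<Phi> z))"
    using diff(2) \<Phi>(3) at_within_open[OF imageI[OF \<Phi>(3)] U(2)]
    unfolding differentiable_on_def differentiable_def by (metis imageI)
  have "((\<lambda>w. inv_into U \<Phi> (\<Phi> w)) has_derivative (\<lambda>w. E (D w))) (at z)"
    using D E by (rule has_derivative_compose)
  then have "((\<lambda>w. w) has_derivative (\<lambda>w. E (D w))) (at z)"
    using U \<Phi>(3) by (elim has_derivative_transform_within_open[of _ _ _ _ U]) auto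
  then have "(\<lambda>w. E (D w)) = (\<lambda>w. w)"
    by (rule has_derivative_unique) (rule has_derivative_ident)
  moreover have "E 0 = 0"
    using E by (simp add: has_derivative_bounded_linear bounded_linear.linear linear_0)
  ultimately have "w = 0" if "D w = 0" for w
    using that by metis
  with D show thesis by (rule that)
qed

section \<open>Orbits of the model maps\<close>

lemma model_funpow_cover:
  assumes "\<bar>a\<bar> < 1" "z \<in> strip"
  shows "(model a ^^ n) (cover z) = cover ((model_lift a ^^ n) z)"
proof -
  have "(model_lift a ^^ n) z \<in> strip \<and> (model a ^^ n) (cover z) = cover ((model_lift a ^^ n) z)"
    using assms by (induction n) (auto simp: model_lift_in_strip model_cover)
  then show ?thesis ..
qed

lemma model_lift_funpow:
  "(model_lift a ^^ n) z = ((sine_map (2 * pi) a ^^ n) (fst z), (sine_map pi a ^^ n) (snd z))"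
  by (induction n) (simp_all add: model_lift_def prod_map_def)

lemma model_lift_iterates_converge:
  assumes "\<bar>a\<bar> < 1"
  shows "\<exists>q. (\<lambda>n. (model_lift a ^^ n) z) \<longlonglongrightarrow> q \<and> model_lift a q = q"
proof -
  obtain q1 where "(\<lambda>n. (sine_map (2 * pi) a ^^ n) (fst z)) \<longlonglongrightarrow> q1" "sine_map (2 * pi) a q1 = q1"
    using sine_map_iterates_converge[of "2 * pi"] assms by auto
  moreover obtain q2 where "(\<lambda>n. (sine_map pi a ^^ n) (snd z)) \<longlonglongrightarrow> q2" "sine_map pi a q2 = q2"
    using sine_map_iterates_converge[of pi] assms by auto
  ultimately have "(\<lambda>n. (model_lift a ^^ n) z) \<longlonglongrightarrow> (q1, q2) \<and> model_lift a (q1, q2) = (q1, q2)"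
    unfolding model_lift_funpow by (auto simp: model_lift_def prod_map_def intro: tendsto_Pair)
  then show ?thesis by blast
qed

lemma isCont_model_lift_funpow: "isCont (model_lift a ^^ n) z"
proof -
  have iter: "isCont (sine_map b a ^^ n) x" if "b \<noteq> 0" for b x
  proof (induction n arbitrary: x)
    case (Suc n)
    then show ?case
      using isCont_o2[OF Suc isCont_sine_map[OF that]] by (simp add: o_def)
  qed (simp add: id_def)
  show ?thesis
    unfolding model_lift_funpow[abs_def]
    by (intro continuous_intros isCont_o2[OF _ iter]) auto
qed

text \<open>A nontrivial integer translation moves every point by at least 1.\<close>

lemma cover_eq_imp_eq:
  assumes "cover z = cover w" "dist z w < 1"
  shows "z = w"
  using assms dist_fst_le[of z w] Ints_nonzero_abs_less1[of "fst z - fst w"]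
  unfolding cover_eq_iff by (auto simp: dist_real_def prod_eq_iff)

text \<open>These are the translation vectors relating points with the same image under
  \<open>cover\<close>; closedness lets such coincidences pass to limits.\<close>

lemma closed_deck: "closed (\<int> \<times> {0} :: (real \<times> real) set)"
  by (intro closed_Times closed_Ints) auto

section \<open>A periodic boundary point and its two incompatible multipliers\<close>

lemma near_id_not_renormalizable:
  assumes "g \<in> near_id"
  shows "\<not> is_total_renormalization 2 (model (1/2)) g"
proof
  let ?G = "model (1/2)" and ?F = "model_lift (1/2)"
  assume "is_total_renormalization 2 ?G g"
  then obtain \<Delta> H N where \<Delta>: "submanifold_with_corners 2 \<Delta>" "\<Delta> \<subset> annulus"
    and H: "bij_betw H \<Delta> annulus" "local_Cr_diffeo 2 \<Delta> H"
    and ret: "\<And>x. x \<in> \<Delta> \<Longrightarrow> \<exists>n\<ge>1. (g ^^ n) x \<in> \<Delta>"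
    and bound: "\<And>x. x \<in> \<Delta> \<Longrightarrow> return_time g \<Delta> x \<le> N"
    and G: "\<And>p. p \<in> annulus \<Longrightarrow> ?G p = H (first_return g \<Delta> (inv_into \<Delta> H p))"
    and cover: "(\<Union>n. (g ^^ n) ` \<Delta>) = annulus"
    unfolding is_total_renormalization_def by blast
  let ?R = "first_return g \<Delta>"
  have R: "?R x \<in> \<Delta>" if "x \<in> \<Delta>" for x
    using return_time_props(2)[OF ret[OF that]] .
  have GH: "?G (H x) = H (?R x)" if "x \<in> \<Delta>" for x
    using G[of "H x"] H(1) that by (simp add: bij_betw_apply bij_betw_inv_into_left)
  note GH_n = funpow_conjugate[of \<Delta> ?R ?G H, OF R GH]
  obtain \<phi> \<phi>' :: "real \<Rightarrow> real" where g: "\<And>t. g (cover (t, 0)) = cover (\<phi> t, 0)"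
    and deg: "\<And>t. \<phi> (t + 1) = \<phi> t + 1"
    and deriv: "\<And>t. (\<phi> has_real_derivative \<phi>' t) (at t)"
    and pos: "\<And>t. 0 < \<phi>' t"
    and lip: "\<And>s t. \<bar>ln (\<phi>' s) - ln (\<phi>' t)\<bar> \<le> 1 / 4 * \<bar>s - t\<bar>"
    using near_id_boundary_map[OF assms] by blast
  note shift = funpow_add_int[of \<phi>, OF deg]
  have g_n: "(g ^^ n) (cover (t, 0)) = cover ((\<phi> ^^ n) t, 0)" for n t
    by (induction n) (simp_all add: g)
  define D where "D = {t. cover (t, 0) \<in> \<Delta>}"
  have "\<exists>s\<in>D. \<forall>e>0. \<forall>M. \<exists>n\<ge>M. \<exists>k::int.
      (\<phi> ^^ n) s + of_int k \<in> D \<and> \<bar>(\<phi> ^^ n) s + of_int k - s\<bar> < e"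
  proof (rule ex_recurrent_point[where \<phi> = \<phi> and N = N])
    show "\<phi> (t + 1) = \<phi> t + 1" for t
      by (rule deg)
    show "isCont \<phi> t" for t
      using deriv by (rule DERIV_isCont)
    show "\<exists>U C. open U \<and> t \<in> U \<and> closed C \<and> U \<inter> D = U \<inter> C" if "t \<in> D" for t
      using corner_locally_closed[OF \<Delta>(1), of t] that by (simp add: D_def)
    show "\<exists>n\<le>N. (\<phi> ^^ n) t \<in> D" for t
    proof -
      have "cover (t, 0) \<in> (\<Union>n. (g ^^ n) ` \<Delta>)"
        unfolding cover by (simp add: cover_in_annulus_iff strip_def)
      from bounded_hitting_time[OF ret bound this] show ?thesis
        by (simp add: D_def g_n)
    qed
  qed
  then obtain s where s: "cover (s, 0) \<in> \<Delta>"
    and recurrent: "\<And>e M. 0 < e \<Longrightarrow> \<exists>n\<ge>M. \<exists>k::int.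
      cover ((\<phi> ^^ n) s + of_int k, 0) \<in> \<Delta> \<and> \<bar>(\<phi> ^^ n) s + of_int k - s\<bar> < e"
    unfolding D_def by blast
  obtain U \<Phi> where U: "(s, 0) \<in> U" and \<Phi>: "Cr_diffeo_on 2 U \<Phi>"
    and H_\<Phi>: "\<And>w. w \<in> U \<Longrightarrow> cover w \<in> \<Delta> \<Longrightarrow> H (cover w) = cover (\<Phi> w)"
    using H(2)[unfolded local_Cr_diffeo_def, THEN spec, THEN mp, OF s] by metis
  have U_open: "open U"
    using \<Phi> by (simp add: Cr_diffeo_on_def)
  have \<Phi>_strip: "\<Phi> w \<in> strip" if "w \<in> U" "cover w \<in> \<Delta>" for w
  proof -
    have "H (cover w) \<in> annulus"
      using H(1) that(2) by (rule bij_betw_apply)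
    then show ?thesis
      by (simp add: H_\<Phi>[OF that] cover_in_annulus_iff)
  qed
  obtain E where E: "(\<Phi> has_derivative E) (at (s, 0))" "\<And>w. E w = 0 \<Longrightarrow> w = 0"
    by (rule Cr_diffeo_on_has_derivative[OF \<Phi> _ U]) simp_all
  define A where "A t = \<Phi> (t, 0)" for t
  define P where "P = A s"
  have P: "P \<in> strip" "H (cover (s, 0)) = cover P"
    using \<Phi>_strip[OF U s] H_\<Phi>[OF U s] by (simp_all add: P_def A_def)
  have line: "((\<lambda>t. (t, 0)) has_vector_derivative (1, 0)) (at s)"
    by (intro has_vector_derivative_Pair) auto
  then have A: "(A has_vector_derivative E (1, 0)) (at s)"
    using vector_derivative_diff_chain_within[of "\<lambda>t. (t, 0)" "(1, 0)" s UNIV \<Phi> E]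
      has_derivative_at_withinI[OF E(1)]
    by (simp add: o_def A_def[abs_def])
  then have A_cont: "(A \<longlongrightarrow> P) (at s)"
    using has_vector_derivative_continuous[of A "E (1, 0)" s UNIV] by (simp add: P_def isCont_def)
  have U_ev: "\<forall>\<^sub>F t in nhds s. (t, 0) \<in> U"
  proof -
    have "open ((\<lambda>t. (t, 0)) -` U)"
      using U_open by (intro open_vimage) (auto intro!: continuous_intros)
    then show ?thesis
      using eventually_nhds_in_open[of "(\<lambda>t. (t, 0)) -` U" s] U by simp
  qed
  obtain q where q: "(\<lambda>n. (?F ^^ n) P) \<longlonglongrightarrow> q" "?F q = q"
    using model_lift_iterates_converge[of "1/2" P] by fastforce
  have G_n: "(?G ^^ n) (cover z) = cover ((?F ^^ n) z)" if "z \<in> strip" for n z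
    using model_funpow_cover[of "1/2"] that by simp
  \<comment> \<open>A late return to \<open>t\<close> near \<open>s\<close> makes
    \<open>A t\<close>, close to \<open>P\<close>, agree under \<open>cover\<close> with
    \<open>(?F ^^ r) P\<close>, close to \<open>q\<close>. In the limit \<open>P - q\<close> is a
    translation vector.\<close>
  have cover_P: "cover P = cover q"
  proof -
    have "P - q \<in> \<int> \<times> {0}"
    proof (rule closed_approachable[OF closed_deck, THEN iffD1, rule_format])
      fix e :: real assume e: "0 < e"
      have "\<forall>\<^sub>F t in nhds s. dist (A t) P < e / 2"
        using tendstoD[OF A_cont, of "e / 2"] e by (simp add: eventually_nhds_conv_at P_def)
      with U_ev have "\<forall>\<^sub>F t in nhds s. (t, 0) \<in> U \<and> dist (A t) P < e / 2"
        by eventually_elim simp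
      then obtain d where d: "0 < d" "\<And>t. dist t s < d \<Longrightarrow> (t, 0) \<in> U \<and> dist (A t) P < e / 2"
        unfolding eventually_nhds_metric by blast
      obtain r0 where r0: "\<And>r. r0 \<le> r \<Longrightarrow> dist ((?F ^^ r) P) q < e / 2"
        using metric_LIMSEQ_D[OF q(1), of "e / 2"] e by auto
      \<comment> \<open>From \<open>N * r0 < n \<le> N * r\<close> it follows that
        \<open>r0 < r\<close>, so enough iterates of \<open>?F\<close> are made.\<close>
      obtain n and k :: int where n: "N * r0 + 1 \<le> n" "cover ((\<phi> ^^ n) s + of_int k, 0) \<in> \<Delta>"
        "\<bar>(\<phi> ^^ n) s + of_int k - s\<bar> < d"
        using recurrent[OF d(1), of "N * r0 + 1"] by blast
      define t where "t = (\<phi> ^^ n) s + of_int k"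
      have t: "cover (t, 0) \<in> \<Delta>" "dist t s < d" "(g ^^ n) (cover (s, 0)) = cover (t, 0)"
        using n(2,3) by (simp_all add: t_def dist_real_def g_n cover_add_int)
      obtain r where r: "n \<le> N * r" "(?R ^^ r) (cover (s, 0)) = cover (t, 0)"
        using funpow_return[OF ret bound s, of n] t n(1) by auto
      have "N * r0 < N * r"
        using n(1) r(1) by linarith
      then have "r0 \<le> r" by simp
      have "cover (A t) = H (cover (t, 0))"
        using H_\<Phi> t d(2) by (simp add: A_def)
      also have "\<dots> = cover ((?F ^^ r) P)"
        using GH_n[OF _ _ s, of r] R GH r(2) by (simp add: P(2) G_n[OF P(1)])
      finally have "A t - (?F ^^ r) P \<in> \<int> \<times> {0}"
        by (simp add: cover_eq_iff mem_Times_iff)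
      moreover have "dist (A t - (?F ^^ r) P) (P - q) < e"
      proof -
        have "A t - (?F ^^ r) P - (P - q) = (A t - P) - ((?F ^^ r) P - q)"
          by simp
        then have "dist (A t - (?F ^^ r) P) (P - q) \<le> dist (A t) P + dist ((?F ^^ r) P) q"
          unfolding dist_norm by (simp only: norm_triangle_ineq4)
        also have "\<dots> < e"
          using d(2)[OF t(2)] r0[OF \<open>r0 \<le> r\<close>] by linarith
        finally show ?thesis .
      qed
      ultimately show "\<exists>y\<in>\<int> \<times> {0}. dist y (P - q) < e"
        by (rule rev_bexI)
    qed
    then show ?thesis
      by (simp add: cover_eq_iff mem_Times_iff)
  qed
  then obtain k0 :: int where "P = (fst q + of_int k0, snd q)"
    by (rule cover_eqE)
  then have F_P: "?F P = P"
    using arg_cong[OF q(2), of fst] arg_cong[OF q(2), of snd]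
    by (simp add: model_lift_def prod_map_def sine_map_add_int)
  have F_P_n: "(?F ^^ n) P = P" for n
    by (induction n) (simp_all add: F_P)
  \<comment> \<open>As \<open>?G\<close> fixes \<open>H (cover (s, 0))\<close>, injectivity of
    \<open>H\<close> makes \<open>cover (s, 0)\<close> a fixed point of the first return, so
    \<open>s\<close> is periodic modulo integers.\<close>
  have "H (?R (cover (s, 0))) = H (cover (s, 0))"
    using GH[OF s] model_cover[OF P(1), of "1/2"] by (simp add: P(2) F_P)
  then have "?R (cover (s, 0)) = cover (s, 0)"
    using H(1) R[OF s] s by (auto simp: bij_betw_def dest: inj_onD)
  then have "cover ((\<phi> ^^ return_time g \<Delta> (cover (s, 0))) s, 0) = cover (s, 0)"
    by (simp add: first_return_def g_n)
  then have "\<exists>n. 0 < n \<and> (\<phi> ^^ n) s - s \<in> \<int>"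
    using return_time_props(1)[OF ret[OF s]]
    by (intro exI[of _ "return_time g \<Delta> (cover (s, 0))"]) (simp add: cover_eq_iff)
  then obtain m where m: "0 < m" "(\<phi> ^^ m) s - s \<in> \<int>"
    and m_min: "\<And>n. 0 < n \<Longrightarrow> n < m \<Longrightarrow> (\<phi> ^^ n) s - s \<notin> \<int>"
    using exists_least_iff[of "\<lambda>n. 0 < n \<and> (\<phi> ^^ n) s - s \<in> \<int>"] by metis
  then obtain p :: int where "(\<phi> ^^ m) s - s = of_int p"
    by (elim Ints_cases)
  then have p: "(\<phi> ^^ m) s = s + of_int p" by simp
  define \<mu> where "\<mu> = (\<Prod>i<m. \<phi>' ((\<phi> ^^ i) s))"
  have \<mu>: "\<bar>ln \<mu>\<bar> \<le> 1 / 4"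
    unfolding \<mu>_def
    by (rule periodic_multiplier_bound[where \<phi> = \<phi> and \<phi>' = \<phi>' and p = p])
      (use deg deriv pos lip m(1) p m_min in blast)+
  \<comment> \<open>Subtracting \<open>p\<close> makes \<open>s\<close> a fixed point on the line,
    with multiplier \<open>\<mu>\<close>.\<close>
  define \<psi> where "\<psi> t = (\<phi> ^^ m) t - of_int p" for t
  have \<psi>_s: "\<psi> s = s"
    by (simp add: \<psi>_def p)
  have \<phi>_n: "((\<phi> ^^ m) has_real_derivative (\<Prod>i<m. \<phi>' ((\<phi> ^^ i) t))) (at t)" for t
    using deriv by (rule funpow_has_real_derivative[of \<phi> \<phi>'])
  then have \<psi>: "(\<psi> has_real_derivative (\<Prod>i<m. \<phi>' ((\<phi> ^^ i) t))) (at t)" for t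
    unfolding \<psi>_def[abs_def] using DERIV_diff[OF \<phi>_n DERIV_const] by simp
  have \<psi>_mono: "\<psi> t < \<psi> u" if "t < u" for t u
  proof (rule DERIV_pos_imp_increasing[OF that])
    show "\<exists>y. (\<psi> has_real_derivative y) (at x) \<and> 0 < y" for x
      using \<psi> pos by (intro exI[of _ "\<Prod>i<m. \<phi>' ((\<phi> ^^ i) x)"]) (simp add: prod_pos)
  qed
  have \<psi>_cont: "(\<psi> \<longlongrightarrow> s) (at s within S)" for S
    using DERIV_isCont[OF \<psi>, of s] \<psi>_s by (auto simp: isCont_def intro: tendsto_within_subset)
  obtain S where S: "S \<in> {{s<..}, {..<s}}" and arc: "\<forall>\<^sub>F t in at s within S. cover (t, 0) \<in> \<Delta>"
    using corner_boundary_arc[OF \<Delta>(1) s] by blast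
  let ?L = "at s within S"
  have nontrivial: "?L \<noteq> bot"
    using S by (auto simp: trivial_limit_at_right_real trivial_limit_at_left_real)
  \<comment> \<open>Being increasing, \<open>\<psi>\<close> preserves the side \<open>S\<close> of
    \<open>s\<close>; properties valid near \<open>s\<close> on that side therefore hold at
    \<open>\<psi> t\<close> too.\<close>
  have \<psi>_lim: "filterlim \<psi> ?L ?L"
    unfolding filterlim_at
  proof
    have "\<psi> t \<in> S \<and> \<psi> t \<noteq> s" if "t \<in> S" for t
      using S that \<psi>_mono[of s t] \<psi>_mono[of t s] \<psi>_s by auto
    then show "\<forall>\<^sub>F t in ?L. \<psi> t \<in> S \<and> \<psi> t \<noteq> s"
      by (auto simp: eventually_at_filter)
  qed (rule \<psi>_cont)
  have U_L: "\<forall>\<^sub>F t in ?L. (t, 0) \<in> U"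
    using U_ev by (simp add: eventually_at_filter eventually_mono)
  have A_L: "(A \<longlongrightarrow> P) ?L"
    using A_cont by (rule tendsto_within_subset) simp
  \<comment> \<open>Two points closer than \<open>1/2\<close> to \<open>P\<close> are less than 1
    apart, so \<open>cover\<close> separates them.\<close>
  have F_L: "\<forall>\<^sub>F t in ?L. dist ((?F ^^ j) (A t)) P < 1 / 2" for j
  proof (rule tendstoD)
    show "((\<lambda>t. (?F ^^ j) (A t)) \<longlongrightarrow> P) ?L"
      using isCont_tendsto_compose[OF isCont_model_lift_funpow A_L, of j "1/2"] by (simp add: F_P_n)
  qed simp
  then have F_L_all: "\<forall>\<^sub>F t in ?L. \<forall>j\<in>{1..m}. dist ((?F ^^ j) (A t)) P < 1 / 2"
    by (simp add: eventually_ball_finite)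
  have "\<forall>\<^sub>F t in ?L. cover (t, 0) \<in> \<Delta> \<and> (t, 0) \<in> U \<and> dist (A t) P < 1 / 2"
    using arc U_L F_L[of 0] by eventually_elim simp
  note near = this eventually_compose_filterlim[OF this \<psi>_lim]
  \<comment> \<open>For \<open>t\<close> on the arc, \<open>g ^^ m\<close> is a return to
    \<open>\<Delta>\<close>, made of at most \<open>m\<close> first returns; \<open>H\<close> turns
    them into iterates of \<open>?G\<close>. Closeness to \<open>P\<close> lifts the resulting
    identity to the strip.\<close>
  have key: "\<forall>\<^sub>F t in ?L. \<exists>j\<in>{1..m}. A (\<psi> t) = (?F ^^ j) (A t)"
    using near F_L_all
  proof eventually_elim
    case (elim t)
    have \<psi>_t: "cover (\<psi> t, 0) = (g ^^ m) (cover (t, 0))"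
      using cover_add_int[of "(\<phi> ^^ m) t" "- p" 0] by (simp add: g_n \<psi>_def)
    then obtain j where j: "1 \<le> j" "j \<le> m" "(?R ^^ j) (cover (t, 0)) = cover (\<psi> t, 0)"
      using funpow_return[OF ret bound, of "cover (t, 0)" m] elim m(1) by auto
    have "cover (A (\<psi> t)) = H (cover (\<psi> t, 0))"
      using H_\<Phi>[of "(\<psi> t, 0)"] elim by (simp add: A_def)
    also have "\<dots> = (?G ^^ j) (H (cover (t, 0)))"
      using GH_n[of "cover (t, 0)" j] R GH j(3) elim by simp
    also have "\<dots> = cover ((?F ^^ j) (A t))"
      using H_\<Phi>[of "(t, 0)"] \<Phi>_strip[of "(t, 0)"] elim by (simp add: A_def G_n)
    finally have "cover (A (\<psi> t)) = cover ((?F ^^ j) (A t))" .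
    moreover have "dist (A (\<psi> t)) ((?F ^^ j) (A t)) < 1"
      using elim j dist_triangle2[of "A (\<psi> t)" "(?F ^^ j) (A t)" P] by force
    ultimately have "A (\<psi> t) = (?F ^^ j) (A t)"
      by (rule cover_eq_imp_eq)
    with j show ?case by auto
  qed
  have \<psi>_\<mu>: "(\<psi> has_real_derivative \<mu>) (at s)"
    unfolding \<mu>_def by (rule \<psi>)
  \<comment> \<open>The boundary arc has nonzero velocity in the target, hence a nonzero component
    in one of the two factors of the model, where the one-dimensional estimate applies.\<close>
  have "E (1, 0) \<noteq> 0"
    using E(2)[of "(1, 0)"] by (auto simp: zero_prod_def)
  then consider "fst (E (1, 0)) \<noteq> 0" | "snd (E (1, 0)) \<noteq> 0"
    by (auto simp: prod_eq_iff)
  then have "1 / 4 < \<bar>ln \<mu>\<bar>"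
  proof cases
    case 1
    show ?thesis
    proof (rule sine_map_semiconjugate_multiplier[where b = "2 * pi" and a = "\<lambda>t. fst (A t)" and S = S and m = m])
      show "sine_map (2 * pi) (1/2) (fst (A s)) = fst (A s)"
        using arg_cong[OF F_P, of fst] by (simp add: model_lift_def prod_map_def P_def)
      show "((\<lambda>t. fst (A t)) has_real_derivative fst (E (1, 0))) (at s)"
        using bounded_linear.has_vector_derivative[OF bounded_linear_fst A]
        by (simp add: has_real_derivative_iff_has_vector_derivative)
      have "\<forall>\<^sub>F t in ?L. \<exists>j\<in>{1..m}. fst (A (\<psi> t)) = (sine_map (2 * pi) (1/2) ^^ j) (fst (A t))"
        using key by eventually_elim (auto simp: model_lift_funpow)
      then show "\<exists>\<^sub>F t in ?L. \<exists>j\<in>{1..m}. fst (A (\<psi> t)) = (sine_map (2 * pi) (1/2) ^^ j) (fst (A t))"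
        by (rule eventually_frequently[OF nontrivial])
    qed (use 1 \<psi>_\<mu> \<psi>_s in auto)
  next
    case 2
    show ?thesis
    proof (rule sine_map_semiconjugate_multiplier[where b = pi and a = "\<lambda>t. snd (A t)" and S = S and m = m])
      show "sine_map pi (1/2) (snd (A s)) = snd (A s)"
        using arg_cong[OF F_P, of snd] by (simp add: model_lift_def prod_map_def P_def)
      show "((\<lambda>t. snd (A t)) has_real_derivative snd (E (1, 0))) (at s)"
        using bounded_linear.has_vector_derivative[OF bounded_linear_snd A]
        by (simp add: has_real_derivative_iff_has_vector_derivative)
      have "\<forall>\<^sub>F t in ?L. \<exists>j\<in>{1..m}. snd (A (\<psi> t)) = (sine_map pi (1/2) ^^ j) (snd (A t))"
        using key by eventually_elim (auto simp: model_lift_funpow)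
      then show "\<exists>\<^sub>F t in ?L. \<exists>j\<in>{1..m}. snd (A (\<psi> t)) = (sine_map pi (1/2) ^^ j) (snd (A t))"
        by (rule eventually_frequently[OF nontrivial])
    qed (use 2 \<psi>_\<mu> \<psi>_s in auto)
  qed
  with \<mu> show False by simp
qed

theorem corollary0p11:
  shows "\<exists>G\<in>Diff0 \<infinity>. \<exists>\<N>. openin (Cr_topology 2) \<N> \<and> id_annulus \<in> \<N> \<and>
    (\<forall>g\<in>\<N>. \<not> is_total_renormalization 2 G g)"
  using model_in_Diff0[of "1/2"] openin_near_id id_in_near_id near_id_not_renormalizable
  by (intro bexI[of _ "model (1/2)"] exI[of _ near_id]) auto

end
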